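(* Let $V$ be a complex Banach space, $R\subset V$ a closed convex cone and $C\subset V$ a complex cone such that: (C1) $C=\mathbb{C}^*R$ and $\overline{(R+iR)}\cap\overline{(R-iR)}=R$; (C2) $C$ is proper and contains at least two (complex) linearly independent vectors. Then $$ \forall x,y\in C\setminus\{0\},\quad \frac12\,\delta_C(x,y)\leq d_C(x,y). $$
   Context: $\mathbb{C}^*=\mathbb{C}\setminus\{0\}$ and $\hat{\mathbb{C}}$ is the Riemann sphere. A complex cone is a non-empty subset $C\subset V$ with $\mathbb{C}^*C\subset C$; it is proper if its closure contains no complex vector subspace of complex dimension 2. A closed convex cone $R\subset V$ is a closed non-empty subset with $R+R\subset R$ and $(0,\infty)R\subset R$. (Condition (C1) implies that $C$ is closed.) For $x,y\in C\setminus\{0\}$ let $E_C(x,y)=\{z\in\mathbb{C}: zx-y\notin C\}$. If $x,y$ are colinear, $\delta_C(x,y)=0$; if $x,y$ are linearly independent, $\delta_C(x,y)=\log(b/a)\in[0,\infty]$ with $b=\sup\{|z|:z\in E_C(x,y)\}\in(0,\infty]$, $a=\inf\{|z|:z\in E_C(x,y)\}\in[0,\infty)$ (equal to $\infty$ if $b=\infty$ or $a=0$). Let $L(x,y)=\{z\in\hat{\mathbb{C}}: zx-y\in C\}$, with the convention $\infty\in L(x,y)$, and let $\mathring{L}(x,y)$ be its interior in $\hat{\mathbb{C}}$ (under (C1)-(C2) it is simply connected when non-empty). The gauge $d_C$ (Rugh) is defined for $x,y\in C\setminus\{0\}$ by: $d_C(x,y)=0$ if $x,y$ are colinear; if $x,y$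 are linearly independent and $0,\infty\in\mathring{L}(x,y)$, then $d_C(x,y)$ is the Poincaré distance between $0$ and $\infty$ in the hyperbolic Riemann surface $\mathring{L}(x,y)$, normalized to have Gaussian curvature $-1$ (on the unit disk the metric is $2|dz|/(1-|z|^2)$); $d_C(x,y)=\infty$ otherwise. *)

theory Defs
  imports "HOL-Complex_Analysis.Complex_Analysis"
begin

section \<open>Complex Banach spaces\<close>

text \<open>
  The complex scalar multiplication is required to extend the real one of the underlying real
  Banach space, so norm, topology and completeness are those of \<^class>\<open>banach\<close>.
\<close>

class complex_banach = banach +
  fixes scaleC :: "complex \<Rightarrow> 'a \<Rightarrow> 'a"  (infixr \<open>*\<^sub>C\<close> 75)
  assumes scaleC_add_right: "a *\<^sub>C (x + y) = a *\<^sub>C x + a *\<^sub>C y"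
    and scaleC_add_left: "(a + b) *\<^sub>C x = a *\<^sub>C x + b *\<^sub>C x"
    and scaleC_scaleC: "a *\<^sub>C (b *\<^sub>C x) = (a * b) *\<^sub>C x"
    and scaleC_of_real: "complex_of_real r *\<^sub>C x = r *\<^sub>R x"
    and norm_scaleC: "norm (a *\<^sub>C x) = cmod a * norm x"

lemma scaleC_one: "1 *\<^sub>C x = (x :: 'a :: complex_banach)"
  using scaleC_of_real[of 1 x] by simp

global_interpretation complex_vs: vector_space "scaleC :: complex \<Rightarrow> 'a \<Rightarrow> 'a :: complex_banach"
  defines complex_subspace = complex_vs.subspace
    and complex_dim = complex_vs.dim
  by unfold_locales (simp_all add: scaleC_add_right scaleC_add_left scaleC_scaleC scaleC_one)

definition colinear :: "'a :: complex_banach \<Rightarrow> 'a \<Rightarrow> bool" where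
  "colinear x y \<longleftrightarrow> (\<exists>a b. (a \<noteq> 0 \<or> b \<noteq> 0) \<and> a *\<^sub>C x + b *\<^sub>C y = 0)"


section \<open>Cones\<close>

definition closed_convex_cone :: "'a :: real_normed_vector set \<Rightarrow> bool" where
  "closed_convex_cone R \<longleftrightarrow> closed R \<and> R \<noteq> {} \<and> (\<forall>u\<in>R. \<forall>v\<in>R. u + v \<in> R) \<and>
     (\<forall>t>0. \<forall>u\<in>R. t *\<^sub>R u \<in> R)"

definition is_complex_cone :: "'a :: complex_banach set \<Rightarrow> bool" where
  "is_complex_cone C \<longleftrightarrow> C \<noteq> {} \<and> (\<forall>c. c \<noteq> 0 \<longrightarrow> (\<forall>x\<in>C. c *\<^sub>C x \<in> C))"

definition proper_cone :: "'a :: complex_banach set \<Rightarrow> bool" where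
  "proper_cone C \<longleftrightarrow> \<not> (\<exists>S. complex_subspace S \<and> complex_dim S = 2 \<and> S \<subseteq> closure C)"

definition cond_C1 :: "'a :: complex_banach set \<Rightarrow> 'a set \<Rightarrow> bool" where
  "cond_C1 R C \<longleftrightarrow>
     C = {c *\<^sub>C u | c u. c \<noteq> 0 \<and> u \<in> R} \<and>
     closure {u + \<i> *\<^sub>C v | u v. u \<in> R \<and> v \<in> R} \<inter>
     closure {u - \<i> *\<^sub>C v | u v. u \<in> R \<and> v \<in> R} = R"

definition cond_C2 :: "'a :: complex_banach set \<Rightarrow> bool" where
  "cond_C2 C \<longleftrightarrow> proper_cone C \<and> (\<exists>x\<in>C. \<exists>y\<in>C. \<not> colinear x y)"


section \<open>The projective gauge \<open>\<delta>\<close>\<close>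

definition E_set :: "'a :: complex_banach set \<Rightarrow> 'a \<Rightarrow> 'a \<Rightarrow> complex set" where
  "E_set C x y = {z. z *\<^sub>C x - y \<notin> C}"

text \<open>
  In the finite case \<open>b\<close> and \<open>a\<close> are real numbers; they are only passed through \<^typ>\<open>ereal\<close>
  because the supremum may be infinite.
\<close>

definition delta_gauge :: "'a :: complex_banach set \<Rightarrow> 'a \<Rightarrow> 'a \<Rightarrow> ereal" where
  "delta_gauge C x y =
     (if colinear x y then 0
      else let b = (SUP z\<in>E_set C x y. ereal (cmod z));
               a = (INF z\<in>E_set C x y. ereal (cmod z))
           in if b = \<infinity> \<or> a = 0 then \<infinity> else ereal (ln (real_of_ereal b / real_of_ereal a)))"


section \<open>The Riemann sphere\<close>

datatype riemann_sphere = Finite_Pt complex | Infinity_Pt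

text \<open>The topology is that of the one-point compactification of the plane.\<close>

instantiation riemann_sphere :: topological_space
begin

definition open_riemann_sphere :: "riemann_sphere set \<Rightarrow> bool" where
  "open_riemann_sphere U \<longleftrightarrow>
     open (Finite_Pt -` U) \<and> (Infinity_Pt \<in> U \<longrightarrow> compact (- (Finite_Pt -` U)))"

instance
proof
  show "open (UNIV :: riemann_sphere set)"
    by (simp add: open_riemann_sphere_def)
next
  fix S T :: "riemann_sphere set"
  assume "open S" "open T"
  then show "open (S \<inter> T)"
    by (auto simp: open_riemann_sphere_def Compl_Int)
next
  fix K :: "riemann_sphere set set"
  assume K: "\<forall>S\<in>K. open S"
  have op: "open (Finite_Pt -` \<Union>K)"
    using K by (auto simp: open_riemann_sphere_def vimage_Union)
  moreover have "compact (- (Finite_Pt -` \<Union>K))" if "Infinity_Pt \<in> \<Union>K"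
  proof -
    from that obtain S where S: "S \<in> K" "Infinity_Pt \<in> S" by blast
    have "compact (- (Finite_Pt -` S))"
      using K S by (auto simp: open_riemann_sphere_def)
    moreover have "- (Finite_Pt -` \<Union>K) = - (Finite_Pt -` S) \<inter> - (Finite_Pt -` \<Union>K)"
      using S by auto
    ultimately show ?thesis
      using op by (metis closed_Compl compact_Int_closed)
  qed
  ultimately show "open (\<Union>K)"
    by (simp add: open_riemann_sphere_def)
qed

end

text \<open>
  The two standard charts \<open>z\<close> and \<open>1/z\<close>; the first is only meaningful off \<open>\<infinity>\<close>, the second
  only off \<open>0\<close>.
\<close>

fun coord_zero :: "riemann_sphere \<Rightarrow> complex" where
  "coord_zero (Finite_Pt z) = z"
| "coord_zero Infinity_Pt = 0"

fun coord_infty :: "riemann_sphere \<Rightarrow> complex" where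
  "coord_infty (Finite_Pt z) = 1 / z"
| "coord_infty Infinity_Pt = 0"

definition holomorphic_to_sphere :: "(complex \<Rightarrow> riemann_sphere) \<Rightarrow> complex set \<Rightarrow> bool" where
  "holomorphic_to_sphere f D \<longleftrightarrow> continuous_on D f \<and>
     (coord_zero \<circ> f) holomorphic_on {z\<in>D. f z \<noteq> Infinity_Pt} \<and>
     (coord_infty \<circ> f) holomorphic_on {z\<in>D. f z \<noteq> Finite_Pt 0}"


section \<open>The Poincare distance\<close>

definition poincare_length :: "(real \<Rightarrow> complex) \<Rightarrow> real" where
  "poincare_length \<gamma> =
     integral {0..1} (\<lambda>t. 2 * cmod (vector_derivative \<gamma> (at t)) / (1 - (cmod (\<gamma> t))\<^sup>2))"

text \<open>
  Only \<open>C\<^sup>1\<close> paths on the closed interval are admitted, so that the integrand is continuous;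
  for piecewise \<open>C\<^sup>1\<close> paths in the sense of \<^const>\<open>valid_path\<close> the speed may be non-integrable,
  and \<^const>\<open>integral\<close> would then be \<open>0\<close>.
\<close>

definition poincare_dist_disc :: "complex \<Rightarrow> complex \<Rightarrow> real" where
  "poincare_dist_disc p q =
     Inf {poincare_length \<gamma> | \<gamma>. \<gamma> C1_differentiable_on {0..1} \<and> path_image \<gamma> \<subseteq> ball 0 1 \<and>
            pathstart \<gamma> = p \<and> pathfinish \<gamma> = q}"

text \<open>
  For a hyperbolic domain \<open>U\<close> the Poincare metric is the one whose pullback under a holomorphic
  universal covering by the unit disc is the metric of the disc. Hence the distance of two points
  of \<open>U\<close> is the infimum of the distances of their lifts. All such coverings agree up to
  automorphisms of the disc, which are isometries, so taking the infimum over all coverings as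
  well changes nothing. If \<open>U\<close> is simply connected, the coverings are the biholomorphic maps from
  the disc onto \<open>U\<close>.
\<close>

definition poincare_dist :: "riemann_sphere set \<Rightarrow> riemann_sphere \<Rightarrow> riemann_sphere \<Rightarrow> ereal" where
  "poincare_dist U p q =
     Inf {ereal (poincare_dist_disc a b) | a b f.
            covering_space (ball 0 1) f U \<and> holomorphic_to_sphere f (ball 0 1) \<and>
            a \<in> ball 0 1 \<and> b \<in> ball 0 1 \<and> f a = p \<and> f b = q}"


section \<open>The gauge \<open>d\<close>\<close>

definition L_set :: "'a :: complex_banach set \<Rightarrow> 'a \<Rightarrow> 'a \<Rightarrow> riemann_sphere set" where
  "L_set C x y = insert Infinity_Pt (Finite_Pt ` {z. z *\<^sub>C x - y \<in> C})"

definition d_gauge :: "'a :: complex_banach set \<Rightarrow> 'a \<Rightarrow> 'a \<Rightarrow> ereal" where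
  "d_gauge C x y =
     (if colinear x y then 0
      else if Finite_Pt 0 \<in> interior (L_set C x y) \<and> Infinity_Pt \<in> interior (L_set C x y)
        then poincare_dist (interior (L_set C x y)) (Finite_Pt 0) Infinity_Pt
      else \<infinity>)"

end

theory Submission
  imports Defs
begin

text \<open>
  Let \<open>E = E_set C x y\<close>, the complement of \<open>L(x, y)\<close> in the sphere. If \<open>0\<close> and \<open>\<infinity>\<close> are interior to \<open>L(x, y)\<close>,
  the claim is that any \<open>p, q \<in> E\<close> satisfy \<open>log (|q| / |p|) \<le> 2 d\<close>, where \<open>d\<close> is the Poincare distance
  of \<open>0\<close> and \<open>\<infinity>\<close> in the interior of \<open>L(x, y)\<close>. Two facts are responsible.

  Convexity: \<open>E\<close> is open and connected (\<open>E_set_open_connected\<close>). Condition (C1) writes \<open>R\<close> as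
  \<open>P \<inter> \<i>P\<close> for the closed convex cone \<open>P\<close> spanned by \<open>R - \<i>R\<close>, so the complex linear functionals with
  nonnegative real part on \<open>P\<close> map \<open>R\<close> into a quarter plane, and \<open>u \<in> C\<close> holds precisely if any two
  of them have values on \<open>u\<close> at an angle of at most \<open>\<pi>/2\<close>. Consequently \<open>E\<close> is a union of convex regions (discs or half
  planes), one for every pair of functionals. Each nonempty one contains a zero of
  \<open>z \<mapsto> m (z x - y)\<close> for some functional \<open>m\<close>, and since the functionals form a convex cone,
  these zeros can be joined to each other inside \<open>E\<close>.

  Conformal geometry: the Moebius map \<open>z \<mapsto> (z - p) / (z - q)\<close> sends \<open>E - {q}\<close> to a
  connected unbounded set \<open>T\<close> containing \<open>0\<close>, and it sends \<open>0, \<infinity>\<close> to \<open>p / q, 1\<close>. Composed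
  with a covering of the interior of \<open>L(x, y)\<close> by the disc it becomes a holomorphic function \<open>H\<close> that avoids
  \<open>T\<close>. The image of \<open>H\<close> lies in a simply connected domain without \<open>0\<close>, and Koebe's quarter theorem
  together with the Schwarz lemma gives \<open>|H'(z)| (1 - |z|\<^sup>2) \<le> 4 |H(z)|\<close>
  (\<open>zero_free_derivative_bound_at\<close>). Hence \<open>|d log H|\<close> is at most twice the Poincare line
  element \<open>2 |dz| / (1 - |z|\<^sup>2)\<close>, and integrating from a preimage of \<open>0\<close> to a preimage of \<open>\<infinity>\<close> gives the
  claim.

  The form of Koebe's theorem used here is derived from the bound \<open>|M'(0)| \<le> 1\<close> for univalent functions \<open>M\<close> with
  \<open>M 0 = 0\<close> and \<open>M z * M w \<noteq> 1\<close> (\<open>Bieberbach_Eilenberg_univalent\<close>). That is proved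
  by comparing areas with respect to the density \<open>1 / |w|\<^sup>2\<close>: the images of an annulus under \<open>M\<close> and
  under \<open>1 / M\<close> are disjoint, both have at least the area of the annulus, and both lie in an annulus that
  is symmetric under inversion and that would be too small if \<open>|M'(0)| > 1\<close>.
\<close>

section \<open>Area integrals in the complex plane\<close>

text \<open>
  The change of variables formula lives on \<open>real^2\<close>; its transfer to \<^typ>\<open>complex\<close> needs
  an isomorphism that preserves boxes and their volume.
\<close>

definition plane_to_complex :: "real^2 \<Rightarrow> complex" where
  "plane_to_complex v = Complex (vec_nth v 1) (vec_nth v 2)"

definition complex_to_plane :: "complex \<Rightarrow> real^2" where
  "complex_to_plane z = vector [Re z, Im z]"

lemma plane_complex_inverse [simp]:
  "plane_to_complex (complex_to_plane z) = z" "complex_to_plane (plane_to_complex v) = v"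
  by (simp_all add: plane_to_complex_def complex_to_plane_def vec_eq_iff forall_2)

lemma bounded_linear_plane_to_complex: "bounded_linear plane_to_complex"
  by (rule linear_conv_bounded_linear[THEN iffD1], rule linearI)
    (simp_all add: plane_to_complex_def complex_eq_iff)

lemma bounded_linear_complex_to_plane: "bounded_linear complex_to_plane"
  by (rule linear_conv_bounded_linear[THEN iffD1], rule linearI)
    (simp_all add: complex_to_plane_def vec_eq_iff forall_2)

lemma complex_to_plane_image_cbox:
  "complex_to_plane ` cbox u v = cbox (complex_to_plane u) (complex_to_plane v)"
proof -
  have key: "z \<in> cbox u v \<longleftrightarrow> complex_to_plane z \<in> cbox (complex_to_plane u) (complex_to_plane v)" for z
    by (auto simp: cbox_def Basis_vec_def Basis_complex_def inner_axis forall_2 complex_to_plane_def)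
  show ?thesis
  proof (intro set_eqI iffI)
    fix w assume w: "w \<in> cbox (complex_to_plane u) (complex_to_plane v)"
    then have "plane_to_complex w \<in> cbox u v" using key[of "plane_to_complex w"] by simp
    then have "complex_to_plane (plane_to_complex w) \<in> complex_to_plane ` cbox u v" by (rule imageI)
    then show "w \<in> complex_to_plane ` cbox u v" by simp
  qed (use key in auto)
qed

lemma plane_to_complex_image_cbox:
  "plane_to_complex ` cbox u v = cbox (plane_to_complex u) (plane_to_complex v)"
proof -
  have "cbox u v = complex_to_plane ` cbox (plane_to_complex u) (plane_to_complex v)"
    by (simp add: complex_to_plane_image_cbox)
  then show ?thesis by (simp only: image_image plane_complex_inverse image_ident)
qed

lemma measure_plane_to_complex:
  "measure lborel (plane_to_complex ` cbox u v) = measure lborel (cbox u v)"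
proof -
  have B: "(Basis :: (real^2) set) = {axis 1 1, axis 2 1}"
    by (auto simp: Basis_vec_def UNIV_2)
  show ?thesis
    unfolding plane_to_complex_image_cbox content_cbox_if box_eq_empty B Basis_complex_def
    by (simp add: plane_to_complex_def inner_axis axis_eq_axis)
qed

lemma has_integral_plane_cbox:
  fixes f :: "complex \<Rightarrow> 'b::real_normed_vector"
  assumes "(f has_integral i) (cbox a b)"
  shows "((\<lambda>v. f (plane_to_complex v)) has_integral i) (complex_to_plane ` cbox a b)"
proof -
  have "((\<lambda>v. f (plane_to_complex v)) has_integral (1 / 1) *\<^sub>R i) (complex_to_plane ` cbox a b)"
    by (rule has_integral_twiddle[OF _ plane_complex_inverse(2) plane_complex_inverse(1)])
      (use assms linear_continuous_at[OF bounded_linear_plane_to_complex] in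
        \<open>auto simp: plane_to_complex_image_cbox complex_to_plane_image_cbox
          measure_plane_to_complex[unfolded plane_to_complex_image_cbox]\<close>)
  then show ?thesis by simp
qed

lemma has_integral_complex_cbox:
  fixes f :: "complex \<Rightarrow> 'b::real_normed_vector"
  assumes "((\<lambda>v. f (plane_to_complex v)) has_integral i) (complex_to_plane ` cbox a b)"
  shows "(f has_integral i) (cbox a b)"
proof -
  have eq: "plane_to_complex ` cbox (complex_to_plane a) (complex_to_plane b) = cbox a b"
    by (simp add: plane_to_complex_image_cbox)
  have "((\<lambda>z. f (plane_to_complex (complex_to_plane z))) has_integral (1 / 1) *\<^sub>R i)
       (plane_to_complex ` cbox (complex_to_plane a) (complex_to_plane b))"
  proof (rule has_integral_twiddle[OF _ plane_complex_inverse(1) plane_complex_inverse(2)])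
    show "measure lborel (complex_to_plane ` cbox u v) = 1 * measure lborel (cbox u v)" for u v
      using measure_plane_to_complex[of "complex_to_plane u" "complex_to_plane v"]
      by (simp add: plane_to_complex_image_cbox complex_to_plane_image_cbox)
    show "((\<lambda>x. f (plane_to_complex x)) has_integral i) (cbox (complex_to_plane a) (complex_to_plane b))"
      using assms by (simp add: complex_to_plane_image_cbox)
  qed (use linear_continuous_at[OF bounded_linear_complex_to_plane] in
        \<open>auto simp: plane_to_complex_image_cbox complex_to_plane_image_cbox\<close>)
  then show ?thesis by (simp add: eq)
qed

lemma has_integral_plane_iff:
  fixes f :: "complex \<Rightarrow> 'b::banach"
  assumes "bounded S"
  shows "((\<lambda>v. f (plane_to_complex v)) has_integral i) (complex_to_plane ` S) \<longleftrightarrow> (f has_integral i) S"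
proof -
  obtain a b where ab: "S \<subseteq> cbox a b"
    using assms bounded_subset_cbox_symmetric by blast
  let ?f = "\<lambda>z. if z \<in> S then f z else 0"
  have "((\<lambda>v. f (plane_to_complex v)) has_integral i) (complex_to_plane ` S) \<longleftrightarrow>
    ((\<lambda>v. if v \<in> complex_to_plane ` S then f (plane_to_complex v) else 0) has_integral i) (complex_to_plane ` cbox a b)"
    by (rule has_integral_restrict[symmetric]) (rule image_mono[OF ab])
  also have "(\<lambda>v. if v \<in> complex_to_plane ` S then f (plane_to_complex v) else 0) = (\<lambda>v. ?f (plane_to_complex v))"
  proof
    fix v
    have "v \<in> complex_to_plane ` S \<longleftrightarrow> plane_to_complex v \<in> S"
      using inj_image_mem_iff[OF inj_on_inverseI[of UNIV plane_to_complex complex_to_plane], of "plane_to_complex v" S]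
      by simp
    then show "(if v \<in> complex_to_plane ` S then f (plane_to_complex v) else 0) = ?f (plane_to_complex v)"
      by simp
  qed
  also have "((\<lambda>v. ?f (plane_to_complex v)) has_integral i) (complex_to_plane ` cbox a b) \<longleftrightarrow> (?f has_integral i) (cbox a b)"
    by (rule iffI[OF has_integral_complex_cbox has_integral_plane_cbox])
  also have "\<dots> \<longleftrightarrow> (f has_integral i) S"
    by (rule has_integral_restrict[OF ab])
  finally show ?thesis .
qed

lemma det_complex_mult:
  "det (matrix (\<lambda>v. complex_to_plane (d * plane_to_complex v))) = (cmod d)\<^sup>2"
  unfolding cmod_power2
  by (simp add: det_2 matrix_def complex_to_plane_def plane_to_complex_def axis_def power2_eq_square)

text \<open>
  By the Cauchy-Riemann equations the Jacobian determinant of a holomorphic map is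
  \<open>|P'|\<^sup>2\<close>. Convexity of \<open>S\<close> serves to make it and its copy in \<open>real^2\<close> measurable.
\<close>

lemma holomorphic_change_of_variables:
  fixes P P' :: "complex \<Rightarrow> complex" and u :: "complex \<Rightarrow> real"
  assumes S: "convex S" "bounded S"
    and bdd: "bounded (P ` S)"
    and der: "\<And>z. z \<in> S \<Longrightarrow> (P has_field_derivative P' z) (at z)"
    and inj: "inj_on P S"
    and nonneg: "\<And>z. u z \<ge> 0"
    and int: "((\<lambda>z. (cmod (P' z))\<^sup>2 * u (P z)) has_integral i) S"
  shows "(u has_integral i) (P ` S)"
proof -
  let ?p = plane_to_complex and ?c = complex_to_plane
  define g where "g = ?c \<circ> P \<circ> ?p"
  define g' where "g' = (\<lambda>x v. ?c (P' (?p x) * ?p v))"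
  define f where "f = (\<lambda>v. vec (u (?p v)) :: real^1)"
  have gS: "g ` ?c ` S = ?c ` P ` S"
    by (simp add: g_def image_comp o_def)
  have meas: "?c ` S \<in> sets lebesgue"
    using S bounded_linear_complex_to_plane
    by (intro fmeasurableD measurable_convex convex_linear_image bounded_linear_image)
       (auto simp: bounded_linear.linear)
  have derg: "(g has_derivative g' x) (at x within ?c ` S)" if "x \<in> ?c ` S" for x
  proof -
    have "(?p has_derivative ?p) (at x within ?c ` S)"
      by (rule bounded_linear_imp_has_derivative[OF bounded_linear_plane_to_complex])
    moreover have "(P has_derivative (*) (P' (?p x))) (at (?p x))"
      using der[of "?p x"] that by (auto simp: has_field_derivative_def)
    ultimately have "((\<lambda>v. P (?p v)) has_derivative (\<lambda>v. P' (?p x) * ?p v)) (at x within ?c ` S)"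
      using has_derivative_compose by blast
    then have "((\<lambda>v. ?c (P (?p v))) has_derivative g' x) (at x within ?c ` S)"
      unfolding g'_def by (rule bounded_linear.has_derivative[OF bounded_linear_complex_to_plane])
    then show ?thesis by (simp add: g_def o_def)
  qed
  have injg: "inj_on g (?c ` S)"
    using inj by (auto simp: g_def inj_on_def) (metis plane_complex_inverse(1))
  have "((\<lambda>v. (cmod (P' (?p v)))\<^sup>2 * u (P (?p v))) has_integral i) (?c ` S)"
    using int has_integral_plane_iff[OF S(2), of "\<lambda>z. (cmod (P' z))\<^sup>2 * u (P z)"] by simp
  moreover have "(\<lambda>v. vec_nth (\<bar>det (matrix (g' v))\<bar> *\<^sub>R f (g v)) 1) = (\<lambda>v. (cmod (P' (?p v)))\<^sup>2 * u (P (?p v)))"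
    by (simp add: fun_eq_iff g'_def det_complex_mult f_def g_def)
  ultimately have hi: "((\<lambda>v. vec_nth (\<bar>det (matrix (g' v))\<bar> *\<^sub>R f (g v)) 1) has_integral i) (?c ` S)"
    by simp
  then have "(\<lambda>v. vec_nth (\<bar>det (matrix (g' v))\<bar> *\<^sub>R f (g v)) 1) absolutely_integrable_on ?c ` S"
    by (intro nonnegative_absolutely_integrable_1)
       (auto simp: f_def nonneg has_integral_integrable_integral)
  then have A: "(\<lambda>v. \<bar>det (matrix (g' v))\<bar> *\<^sub>R f (g v)) absolutely_integrable_on ?c ` S \<and>
     integral (?c ` S) (\<lambda>v. \<bar>det (matrix (g' v))\<bar> *\<^sub>R f (g v)) = vec i"
    using hi unfolding absolutely_integrable_on_1_iff integral_on_1_eq by (auto simp: o_def has_integral_iff)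
  have "f absolutely_integrable_on g ` ?c ` S \<and> integral (g ` ?c ` S) f = vec i"
    using has_absolute_integral_change_of_variables[OF meas derg injg, of f "vec i"] A by blast
  then have "((\<lambda>v. u (?p v)) has_integral i) (?c ` P ` S)"
    unfolding gS absolutely_integrable_on_1_iff integral_on_1_eq
    by (auto simp: f_def o_def has_integral_iff absolutely_integrable_on_def)
  then show ?thesis
    using has_integral_plane_iff[OF bdd] by blast
qed

lemma integral_complex_rectangle:
  fixes f :: "complex \<Rightarrow> 'b::banach"
  assumes f: "continuous_on (cbox (Complex a c) (Complex b d)) f"
  shows "integral (cbox (Complex a c) (Complex b d)) f = integral {a..b} (\<lambda>x. integral {c..d} (\<lambda>y. f (Complex x y)))"
proof -
  let ?g = "\<lambda>p::real \<times> real. Complex (fst p) (snd p)" and ?h = "\<lambda>z. (Re z, Im z)"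
  let ?I = "integral (cbox (Complex a c) (Complex b d)) f"
  have gim: "?g ` cbox u v = cbox (?g u) (?g v)" for u v
  proof -
    have "z \<in> ?g ` cbox u v \<longleftrightarrow> z \<in> cbox (?g u) (?g v)" for z
    proof -
      have "z \<in> ?g ` cbox u v \<longleftrightarrow> (Re z, Im z) \<in> cbox u v"
        by (auto simp: image_iff complex_eq_iff intro!: bexI[of _ "(Re z, Im z)"])
      also have "\<dots> \<longleftrightarrow> fst u \<le> Re z \<and> Re z \<le> fst v \<and> snd u \<le> Im z \<and> Im z \<le> snd v"
        by (cases u; cases v) (auto simp: cbox_Pair_eq)
      also have "\<dots> \<longleftrightarrow> z \<in> cbox (?g u) (?g v)"
        by (auto simp: cbox_def Basis_complex_def)
      finally show ?thesis .
    qed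
    then show ?thesis by blast
  qed
  have him: "?h ` cbox u v = cbox (?h u) (?h v)" for u v
  proof -
    have "?h ` ?g ` cbox (?h u) (?h v) = cbox (?h u) (?h v)" by (simp add: image_comp o_def)
    then show ?thesis by (simp add: gim)
  qed
  have contg: "isCont ?g p" for p
    unfolding Complex_eq by (intro continuous_intros)
  have "(f has_integral ?I) (cbox (Complex a c) (Complex b d))"
    using integrable_continuous[OF f] by (simp add: integrable_integral)
  then have "((\<lambda>p. f (?g p)) has_integral (1/1) *\<^sub>R ?I) (?h ` cbox (Complex a c) (Complex b d))"
  proof (rule has_integral_twiddle[rotated -1])
    show "measure lborel (?g ` cbox u v) = 1 * measure lborel (cbox u v)" for u v
    proof -
      have "measure lborel (cbox (Complex a c) (Complex b d)) = measure lborel (cbox (a, c) (b, d))" for a b c d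
      proof -
        have "measure lborel (cbox (Complex a c) (Complex b d)) = (if a \<le> b \<and> c \<le> d then (b - a) * (d - c) else 0)"
          by (auto simp: content_cbox_if box_eq_empty Basis_complex_def)
        also have "\<dots> = measure lborel (cbox (a, c) (b, d))"
          unfolding content_Pair by auto
        finally show ?thesis .
      qed
      then show ?thesis
        unfolding gim by (metis mult_1 prod.collapse)
    qed
  qed (use contg in \<open>auto simp: gim him\<close>)
  then have "((\<lambda>p. f (?g p)) has_integral ?I) (cbox (a, c) (b, d))"
    by (simp add: him)
  then have "?I = integral (cbox (a, c) (b, d)) (\<lambda>p. f (?g p))"
    by (simp add: integral_unique)
  also have "\<dots> = integral (cbox a b) (\<lambda>x. integral (cbox c d) (\<lambda>y. f (?g (x, y))))"
  proof (rule integral_prod_continuous)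
    have "continuous_on (cbox (a, c) (b, d)) ?g" using contg by (simp add: continuous_at_imp_continuous_on)
    moreover have "?g ` cbox (a, c) (b, d) \<subseteq> cbox (Complex a c) (Complex b d)" using gim[of "(a,c)" "(b,d)"] by simp
    ultimately show "continuous_on (cbox (a, c) (b, d)) (\<lambda>p. f (?g p))"
      using continuous_on_compose2[OF f] by blast
  qed
  finally show ?thesis by simp
qed

lemma measure_complex_rectangle:
  assumes "a \<le> b" "c \<le> d"
  shows "measure lborel (cbox (Complex a c) (Complex b d)) = (b - a) * (d - c)"
  using assms by (simp add: content_cbox_if box_eq_empty Basis_complex_def)

text \<open>
  The density \<open>1 / |w|\<^sup>2\<close> is the pullback of Lebesgue measure under the logarithm, so the
  integral on the left is the area of the image of \<open>N\<close>, counted modulo the period of \<open>exp\<close>. The set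
  \<open>S\<close> between the open and the closed rectangle allows for half-open strips, on which \<open>exp\<close> is still
  injective.
\<close>

lemma log_area_exp_image:
  assumes N: "N holomorphic_on U" "open U" "cbox a b \<subseteq> U"
    and S: "convex S" "box a b \<subseteq> S" "S \<subseteq> cbox a b"
    and inj: "inj_on (\<lambda>z. exp (N z)) S"
  shows "((\<lambda>w. 1 / (cmod w)\<^sup>2) has_integral integral (cbox a b) (\<lambda>z. (cmod (deriv N z))\<^sup>2))
           ((\<lambda>z. exp (N z)) ` S)"
proof -
  let ?i = "integral (cbox a b) (\<lambda>z. (cmod (deriv N z))\<^sup>2)"
  have "deriv N holomorphic_on U"
    using N by (simp add: holomorphic_deriv)
  then have "continuous_on (cbox a b) (deriv N)"
    using N holomorphic_on_imp_continuous_on continuous_on_subset by blast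
  then have hi: "((\<lambda>z. (cmod (deriv N z))\<^sup>2) has_integral ?i) (cbox a b)"
    by (intro integrable_integral integrable_continuous continuous_intros)
  have 1: "negligible {z \<in> cbox a b - S. (cmod (deriv N z))\<^sup>2 \<noteq> 0}"
    by (rule negligible_subset[OF negligible_frontier_interval[of a b]]) (use S in auto)
  have 2: "negligible {z \<in> S - cbox a b. (cmod (deriv N z))\<^sup>2 \<noteq> 0}"
    by (rule negligible_subset[OF negligible_empty]) (use S in auto)
  have int: "((\<lambda>z. (cmod (deriv N z))\<^sup>2) has_integral ?i) S"
    by (rule has_integral_spike_set_eq[OF 2 1, THEN iffD2, OF hi])
  show ?thesis
  proof (rule holomorphic_change_of_variables[where P' = "\<lambda>z. exp (N z) * deriv N z", OF S(1) _ _ _ inj])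
    show "bounded S"
      using S bounded_cbox bounded_subset by blast
    have "continuous_on (cbox a b) (\<lambda>z. exp (N z))"
      using N by (intro continuous_intros) (meson continuous_on_subset holomorphic_on_imp_continuous_on)
    then have "bounded ((\<lambda>z. exp (N z)) ` cbox a b)"
      by (intro compact_imp_bounded compact_continuous_image) auto
    then show "bounded ((\<lambda>z. exp (N z)) ` S)"
      using S by (meson bounded_subset image_mono)
    show "((\<lambda>z. exp (N z)) has_field_derivative exp (N z) * deriv N z) (at z)" if "z \<in> S" for z
      using that N S by (auto intro!: derivative_eq_intros holomorphic_derivI)
    show "((\<lambda>z. (cmod (exp (N z) * deriv N z))\<^sup>2 * (1 / (cmod (exp (N z)))\<^sup>2)) has_integral ?i) S"
      using int by (simp add: norm_mult power_mult_distrib)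
  qed auto
qed

text \<open>
  Every vertical segment across the rectangle is mapped to a curve whose imaginary part grows by the
  full height, so the mean value of \<open>N'\<close> is \<open>1\<close> and the mean value of \<open>|N'|\<^sup>2\<close> is at least \<open>1\<close>.
\<close>

lemma rectangle_energy_lower_bound:
  assumes N: "N holomorphic_on U" "open U" "cbox (Complex s c) (Complex t d) \<subseteq> U"
    and le: "s \<le> t" "c \<le> d"
    and per: "\<And>x. x \<in> {s..t} \<Longrightarrow> N (Complex x d) - N (Complex x c) = \<i> * of_real (d - c)"
  shows "(t - s) * (d - c) \<le> integral (cbox (Complex s c) (Complex t d)) (\<lambda>z. (cmod (deriv N z))\<^sup>2)"
proof -
  let ?Q = "cbox (Complex s c) (Complex t d)"
  have "deriv N holomorphic_on U"
    using N by (simp add: holomorphic_deriv)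
  then have cont: "continuous_on ?Q (deriv N)"
    using N holomorphic_on_imp_continuous_on continuous_on_subset by blast
  (* Linearise: |w|^2 >= 2 Re w - 1, and the right-hand side integrates exactly. *)
  have inner: "integral {c..d} (\<lambda>y. 2 * Re (deriv N (Complex x y)) - 1) = d - c" if x: "x \<in> {s..t}" for x
  proof -
    have "((\<lambda>y. 2 * Re (deriv N (Complex x y)) - 1) has_integral
       (2 * Im (N (Complex x d)) - d) - (2 * Im (N (Complex x c)) - c)) {c..d}"
    proof (rule fundamental_theorem_of_calculus[OF \<open>c \<le> d\<close>])
      fix y assume y: "y \<in> {c..d}"
      have "Complex x y \<in> U"
        using N(3) x y by (auto simp: cbox_def Basis_complex_def)
      then have "(N has_field_derivative deriv N (Complex x y)) (at (Complex x y))"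
        using N holomorphic_derivI by blast
      moreover have "((\<lambda>y. Complex x y) has_vector_derivative \<i>) (at y within {c..d})"
        unfolding Complex_eq by (auto intro!: derivative_eq_intros simp: has_vector_derivative_def scaleR_conv_of_real)
      ultimately have "(N \<circ> Complex x has_vector_derivative \<i> * deriv N (Complex x y)) (at y within {c..d})"
        by (metis field_vector_diff_chain_within has_field_derivative_at_within)
      then have "((\<lambda>y. Im (N (Complex x y))) has_vector_derivative Re (deriv N (Complex x y))) (at y within {c..d})"
        using bounded_linear.has_vector_derivative[OF bounded_linear_Im] by (fastforce simp: o_def)
      then have "((\<lambda>y. Im (N (Complex x y))) has_real_derivative Re (deriv N (Complex x y))) (at y within {c..d})"
        by (simp add: has_real_derivative_iff_has_vector_derivative)
      from DERIV_diff[OF DERIV_cmult[OF this, of 2] DERIV_ident]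
      show "((\<lambda>y. 2 * Im (N (Complex x y)) - y) has_vector_derivative 2 * Re (deriv N (Complex x y)) - 1) (at y within {c..d})"
        by (simp add: has_real_derivative_iff_has_vector_derivative)
    qed
    moreover have "Im (N (Complex x d)) - Im (N (Complex x c)) = d - c"
      using arg_cong[OF per[OF x], of Im] by simp
    ultimately show ?thesis
      by (simp add: integral_unique)
  qed
  have "(t - s) * (d - c) = integral {s..t} (\<lambda>x. integral {c..d} (\<lambda>y. 2 * Re (deriv N (Complex x y)) - 1))"
  proof -
    have "integral {s..t} (\<lambda>x. integral {c..d} (\<lambda>y. 2 * Re (deriv N (Complex x y)) - 1)) = integral {s..t} (\<lambda>x. d - c)"
      by (rule integral_cong) (rule inner)
    then show ?thesis using le by simp
  qed
  also have "\<dots> = integral ?Q (\<lambda>z. 2 * Re (deriv N z) - 1)"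
    by (rule integral_complex_rectangle[symmetric]) (intro continuous_intros cont)
  also have "\<dots> \<le> integral ?Q (\<lambda>z. (cmod (deriv N z))\<^sup>2)"
  proof (intro integral_le integrable_continuous continuous_intros cont)
    fix z
    have "0 \<le> (Re (deriv N z) - 1)\<^sup>2 + (Im (deriv N z))\<^sup>2" by simp
    then show "2 * Re (deriv N z) - 1 \<le> (cmod (deriv N z))\<^sup>2"
      unfolding cmod_power2 by (simp add: power2_eq_square algebra_simps)
  qed
  finally show ?thesis .
qed

section \<open>Univalent functions in the unit disc\<close>

text \<open>
  If \<open>|M'(0)| > 1\<close>, some disc of radius \<open>\<rho>\<close> has an image that contains a disc of radius
  \<open>q > \<rho>\<close>. Outside of \<open>|z| < \<rho>\<close> the values of \<open>M\<close> avoid this disc by injectivity, and those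
  of \<open>1 / M\<close> avoid it by the hypothesis on products; both therefore lie in \<open>q \<le> |w| \<le> 1 / q\<close>. This annulus
  has logarithmic area \<open>4 \<pi> log (1 / q)\<close>, but it contains the disjoint images of
  \<open>\<rho> \<le> |z| \<le> \<sigma>\<close> under \<open>M\<close> and \<open>1 / M\<close>, each of logarithmic area at least
  \<open>2 \<pi> log (\<sigma> / \<rho>)\<close>. This is impossible for \<open>\<sigma>\<close> close to \<open>1\<close>.
\<close>

lemma Bieberbach_Eilenberg_univalent:
  assumes holM: "M holomorphic_on ball 0 1" and injM: "inj_on M (ball 0 1)" and M0: "M 0 = 0"
    and BE: "\<And>z w. z \<in> ball 0 1 \<Longrightarrow> w \<in> ball 0 1 \<Longrightarrow> M z * M w \<noteq> 1"
  shows "cmod (deriv M 0) \<le> 1"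
proof (rule ccontr)
  assume "\<not> cmod (deriv M 0) \<le> 1"
  then have c: "cmod (deriv M 0) > 1" by simp
  define l where "l = (1 + cmod (deriv M 0)) / 2"
  have l: "1 < l" "l < cmod (deriv M 0)" using c by (simp_all add: l_def)
  obtain k where holk: "k holomorphic_on ball 0 1" and Mk: "\<And>z. cmod z < 1 \<Longrightarrow> M z = z * k z"
    and k0: "deriv M 0 = k 0"
    using Schwarz3[OF holM M0] by metis
  have "k z \<noteq> 0" if "z \<in> ball 0 1" for z
  proof (cases "z = 0")
    case False
    then have "M z \<noteq> M 0" using injM that by (auto simp: inj_on_def)
    then show ?thesis using Mk[of z] that M0 by auto
  qed (use k0 c in auto)
  then obtain \<kappa> where hol\<kappa>: "\<kappa> holomorphic_on ball 0 1" and \<kappa>: "\<And>z. z \<in> ball 0 1 \<Longrightarrow> k z = exp (\<kappa> z)"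
    using contractible_imp_holomorphic_log[OF holk convex_imp_contractible[OF convex_ball]] by metis
  have "isCont k 0"
    using holomorphic_on_imp_continuous_on[OF holk] by (simp add: continuous_on_eq_continuous_at)
  then have "isCont (\<lambda>z. cmod (k z)) 0" by (intro continuous_intros)
  then have "\<forall>\<^sub>F z in at 0. l < cmod (k z)"
    using l k0 order_tendstoD(1) unfolding isCont_def by metis
  then obtain \<delta> where \<delta>: "\<delta> > 0" "\<And>z. z \<noteq> 0 \<Longrightarrow> cmod z < \<delta> \<Longrightarrow> l < cmod (k z)"
    unfolding eventually_at by (auto simp: dist_norm)
  define \<rho> where "\<rho> = min \<delta> 1 / 2"
  have \<rho>: "0 < \<rho>" "\<rho> < 1" "\<rho> < \<delta>" using \<delta> by (auto simp: \<rho>_def)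
  define q where "q = l * \<rho>"
  have q: "0 < q" "\<rho> < q" using \<rho> l by (auto simp: q_def)
  have sub: "ball 0 \<rho> \<subseteq> ball (0::complex) 1" "cball 0 \<rho> \<subseteq> ball (0::complex) 1" using \<rho> by auto
  have ballq: "ball 0 q \<subseteq> M ` ball 0 \<rho>"
  proof -
    have "ball (M 0) q \<subseteq> M ` ball 0 \<rho>"
    proof (rule ball_subset_open_map_image)
      show "continuous_on (closure (ball 0 \<rho>)) M"
        using \<rho> sub continuous_on_subset[OF holomorphic_on_imp_continuous_on[OF holM]] by simp
      show "open (M ` interior (ball 0 \<rho>))"
        using open_mapping_thm3[of M "ball 0 \<rho>"] holM injM sub
        by (simp add: holomorphic_on_subset inj_on_subset)
      show "q \<le> cmod (M z - M 0)" if "z \<in> frontier (ball 0 \<rho>)" for z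
      proof -
        have z: "cmod z = \<rho>" using that \<rho> by (simp add: frontier_ball)
        then have "l < cmod (k z)" using \<delta> \<rho> by auto
        then show ?thesis using Mk[of z] z \<rho> M0 l by (simp add: norm_mult q_def mult.commute)
      qed
    qed (use \<rho> q in auto)
    then show ?thesis by (simp add: M0)
  qed
  have large: "q \<le> cmod (M z)" "q \<le> cmod (1 / M z)" "M z \<noteq> 0" if z: "\<rho> \<le> cmod z" "cmod z < 1" for z
  proof -
    show "q \<le> cmod (M z)"
    proof (rule ccontr)
      assume "\<not> q \<le> cmod (M z)"
      then obtain w where "w \<in> ball 0 \<rho>" "M z = M w" using ballq by force
      moreover have "w = z" using calculation injM z sub by (auto simp: inj_on_def)
      ultimately show False using z by simp
    qed
    then show "M z \<noteq> 0" using q by auto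
    show "q \<le> cmod (1 / M z)"
    proof (rule ccontr)
      assume "\<not> q \<le> cmod (1 / M z)"
      then obtain w where "w \<in> ball 0 \<rho>" "1 / M z = M w" using ballq by force
      then show False using BE[of z w] z sub \<open>M z \<noteq> 0\<close> by (force simp: field_simps)
    qed
  qed
  (* As 1 / l = \<rho> / q, the first bound says \<sigma> / \<rho> > 1 / q: the annulus
     \<rho> \<le> |z| \<le> \<sigma> is too large to fit. *)
  obtain \<sigma> where \<sigma>: "1 / l < \<sigma>" "\<rho> < \<sigma>" "\<sigma> < 1"
    using dense[of "max (1/l) \<rho>" 1] \<rho> l by auto
  (* N is log M in the coordinate s = log z, written so that N (s + 2 \<pi> \<i>) = N s + 2 \<pi> \<i>
     is visible. *)
  define N where "N = (\<lambda>s. s + \<kappa> (exp s))"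
  define U where "U = {s::complex. Re s < 0}"
  define Q where "Q = (\<lambda>s t. cbox (Complex s (-pi)) (Complex t pi))"
  define S where "S = (\<lambda>s t. Q s t \<inter> {z. Im z > - pi})"
  have Q: "z \<in> Q s t \<longleftrightarrow> s \<le> Re z \<and> Re z \<le> t \<and> - pi \<le> Im z \<and> Im z \<le> pi" for z s t
    by (auto simp: Q_def cbox_def Basis_complex_def)
  have S: "convex (S s t)" "box (Complex s (-pi)) (Complex t pi) \<subseteq> S s t" "S s t \<subseteq> Q s t" for s t
  proof -
    show "convex (S s t)"
      unfolding S_def Q_def by (intro convex_Int convex_box convex_halfspace_Im_gt)
  qed (auto simp: S_def Q_def box_def cbox_def Basis_complex_def less_imp_le)
  have inj_exp: "inj_on exp (S s t)" for s t
    by (rule inj_on_inverseI[where g = Ln]) (auto simp: S_def Q Ln_exp)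
  have U: "open U" by (simp add: U_def open_halfspace_Re_lt)
  have expU: "exp s \<in> ball 0 1" if "s \<in> U" for s :: complex
    using that by (simp add: U_def)
  have holN: "N holomorphic_on U"
    unfolding N_def using hol\<kappa> expU
    by (intro holomorphic_intros holomorphic_on_compose_gen[OF holomorphic_on_exp, unfolded o_def]) auto
  have expN: "exp (N s) = M (exp s)" if "s \<in> U" for s
    using expU[OF that] \<kappa>[of "exp s"] Mk[of "exp s"] by (simp add: N_def exp_add)
  have QU: "Q (ln \<rho>) (ln \<sigma>) \<subseteq> U"
  proof -
    have "ln \<sigma> < 0" using \<sigma> \<rho> by simp
    then show ?thesis by (auto simp: Q U_def)
  qed
  have injN: "inj_on (\<lambda>s. exp (N s)) (S (ln \<rho>) (ln \<sigma>))"
  proof (rule inj_onI)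
    fix x y assume xy: "x \<in> S (ln \<rho>) (ln \<sigma>)" "y \<in> S (ln \<rho>) (ln \<sigma>)" "exp (N x) = exp (N y)"
    then have "x \<in> U" "y \<in> U" using S(3) QU by blast+
    then have "exp x = exp y" using xy expN injM expU by (auto simp: inj_on_def)
    then show "x = y" using inj_exp xy by (auto simp: inj_on_def)
  qed
  let ?J = "\<lambda>w. 1 / (cmod w)\<^sup>2"
  let ?A = "(\<lambda>s. exp (N s)) ` S (ln \<rho>) (ln \<sigma>)" and ?A' = "(\<lambda>s. exp (- N s)) ` S (ln \<rho>) (ln \<sigma>)"
  let ?B = "exp ` S (ln q) (- ln q)"
  define e where "e = integral (Q (ln \<rho>) (ln \<sigma>)) (\<lambda>z. (cmod (deriv N z))\<^sup>2)"
  have A: "(?J has_integral e) ?A"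
    unfolding e_def Q_def
    by (rule log_area_exp_image[OF holN U QU[unfolded Q_def] S(1,2) S(3)[unfolded Q_def] injN])
  have A': "(?J has_integral e) ?A'"
  proof -
    have "(?J has_integral integral (Q (ln \<rho>) (ln \<sigma>)) (\<lambda>z. (cmod (deriv (\<lambda>z. - N z) z))\<^sup>2)) ?A'"
      unfolding Q_def
    proof (rule log_area_exp_image[OF _ U QU[unfolded Q_def] S(1,2) S(3)[unfolded Q_def]])
      show "inj_on (\<lambda>z. exp (- N z)) (S (ln \<rho>) (ln \<sigma>))"
        using injN by (auto simp: inj_on_def exp_minus)
    qed (intro holomorphic_intros holN)
    moreover have "deriv (\<lambda>z. - N z) z = - deriv N z" if "z \<in> Q (ln \<rho>) (ln \<sigma>)" for z
      using holN U QU that by (intro deriv_minus) (meson holomorphic_on_imp_differentiable_at subsetD)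
    ultimately show ?thesis by (simp add: e_def cong: integral_cong)
  qed
  have SU: "S (ln \<rho>) (ln \<sigma>) \<subseteq> U" using S(3) QU by (rule subset_trans)
  have "?A \<inter> ?A' = {}"
  proof (rule equals0I, elim IntE imageE)
    fix w x y assume "w = exp (N x)" "w = exp (- N y)"
      and xy: "x \<in> S (ln \<rho>) (ln \<sigma>)" "y \<in> S (ln \<rho>) (ln \<sigma>)"
    then have "exp (N x) * exp (N y) = exp (- N y) * exp (N y)" by simp
    also have "\<dots> = 1" by (simp add: exp_minus)
    finally have "exp (N x) * exp (N y) = 1" .
    moreover have "x \<in> U" "y \<in> U" using SU xy by (simp_all add: subset_iff)
    ultimately show False
      using BE[OF expU expU, of x y] by (simp add: expN)
  qed
  then have un: "(?J has_integral e + e) (?A \<union> ?A')"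
    by (intro has_integral_Un A A') auto
  have "(?J has_integral integral (Q (ln q) (- ln q)) (\<lambda>z. (cmod (deriv (\<lambda>z. z) z))\<^sup>2)) ?B"
    unfolding Q_def
    by (rule log_area_exp_image[where U = UNIV, OF _ _ _ S(1,2) S(3)[unfolded Q_def]])
       (auto intro: inj_exp)
  then have B: "(?J has_integral measure lborel (Q (ln q) (- ln q))) ?B"
    by (simp add: Q_def)
  have zr: "\<rho> \<le> cmod (exp s)" "cmod (exp s) < 1" if "s \<in> S (ln \<rho>) (ln \<sigma>)" for s
  proof -
    have "exp (ln \<rho>) \<le> exp (Re s)" using that by (simp add: S_def Q)
    then show "\<rho> \<le> cmod (exp s)" using \<rho> by simp
    show "cmod (exp s) < 1" using that SU expU by (meson mem_ball_0 subsetD)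
  qed
  have inB: "w \<in> ?B" if "q \<le> cmod w" "cmod (1 / w) \<ge> q" for w
  proof -
    have w: "w \<noteq> 0" using that q by auto
    have "cmod w \<le> 1 / q" using that q w by (simp add: norm_divide field_simps)
    then have "ln (cmod w) \<le> ln (1 / q)" using w q by (subst ln_le_cancel_iff) auto
    moreover have "ln q \<le> ln (cmod w)" using that q w by (subst ln_le_cancel_iff) auto
    ultimately have "Ln w \<in> S (ln q) (- ln q)"
      using w q mpi_less_Im_Ln[OF w] Im_Ln_le_pi[OF w] by (simp add: S_def Q ln_div)
    then show ?thesis using w by (metis exp_Ln imageI)
  qed
  have sub: "?A \<union> ?A' \<subseteq> ?B"
  proof -
    have "exp (N s) \<in> ?B" "exp (- N s) \<in> ?B" if s: "s \<in> S (ln \<rho>) (ln \<sigma>)" for s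
    proof -
      have "s \<in> U" using s SU by (rule subsetD[rotated])
      then have "exp (N s) = M (exp s)" "exp (- N s) = 1 / M (exp s)"
        by (simp_all add: expN exp_minus divide_inverse)
      then show "exp (N s) \<in> ?B" "exp (- N s) \<in> ?B"
        using large[OF zr[OF s]] inB by simp_all
    qed
    then show ?thesis by blast
  qed
  have "e + e \<le> measure lborel (Q (ln q) (- ln q))"
    by (rule has_integral_subset_le[OF sub un B]) auto
  moreover have "(ln \<sigma> - ln \<rho>) * (pi - - pi) \<le> e"
    unfolding e_def Q_def
  proof (rule rectangle_energy_lower_bound[OF holN U QU[unfolded Q_def]])
    show "ln \<rho> \<le> ln \<sigma>" using \<rho> \<sigma> by simp
    fix x
    have "exp (Complex x pi) = exp (Complex x (- pi))" by (simp add: exp_eq_polar complex_eq_iff)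
    then have "N (Complex x pi) - N (Complex x (- pi)) = Complex x pi - Complex x (- pi)"
      by (simp add: N_def)
    also have "\<dots> = \<i> * complex_of_real (pi - - pi)" by (simp add: complex_eq_iff)
    finally show "N (Complex x pi) - N (Complex x (- pi)) = \<i> * complex_of_real (pi - - pi)" .
  qed auto
  moreover have "ln q \<le> - ln q"
  proof -
    have "q * q \<le> cmod (M (of_real \<rho>)) * cmod (1 / M (of_real \<rho>))"
      using large[of "of_real \<rho>"] \<rho> q by (intro mult_mono) auto
    also have "\<dots> = 1"
      using large(3)[of "of_real \<rho>"] \<rho> by (simp add: norm_divide)
    finally have "q \<le> 1"
      using q mult_mono[of 1 q 1 q] by (meson less_le_trans not_le_imp_less less_1_mult not_less)
    then show ?thesis using q by simp
  qed
  ultimately have "(ln \<sigma> - ln \<rho>) * (2 * pi) \<le> (- ln q) * (2 * pi)"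
    using measure_complex_rectangle[of "ln q" "- ln q" "-pi" pi] by (simp add: Q_def mult_ac)
  then have "ln \<sigma> - ln \<rho> \<le> - ln q"
    by (subst (asm) mult_le_cancel_right) simp
  then have "ln (\<sigma> * q) \<le> ln \<rho>" using \<sigma> \<rho> q by (simp add: ln_mult)
  then have "\<sigma> * q \<le> \<rho>" using \<sigma> \<rho> q by simp
  then show False using \<sigma> \<rho> l by (simp add: q_def field_simps)
qed

text \<open>
  With \<open>r\<close> a square root of \<open>g\<close>, injectivity of \<open>g\<close> says that \<open>r z + r w\<close> never
  vanishes and that \<open>r\<close> is injective. The Moebius map that turns the involution \<open>w \<mapsto> - w\<close> into
  \<open>w \<mapsto> 1 / w\<close> and \<open>r 0\<close> into \<open>0\<close> therefore produces a function \<open>M\<close> as in the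
  preceding lemma, and \<open>M'(0) = g'(0) / (4 g(0))\<close>.
\<close>

lemma Koebe_zero_free:
  assumes holg: "g holomorphic_on ball 0 1" and inj: "inj_on g (ball 0 1)"
    and nz: "\<And>z. z \<in> ball 0 1 \<Longrightarrow> g z \<noteq> 0"
  shows "cmod (deriv g 0) \<le> 4 * cmod (g 0)"
proof -
  obtain l where hol: "l holomorphic_on ball 0 1" and l: "\<And>z. z \<in> ball 0 1 \<Longrightarrow> g z = exp (l z)"
    using contractible_imp_holomorphic_log[OF holg convex_imp_contractible[OF convex_ball] nz] by metis
  define r where "r = (\<lambda>z. exp (l z / 2))"
  define M where "M = (\<lambda>z. (r z - r 0) / (r z + r 0))"
  have r0: "r z \<noteq> 0" for z by (simp add: r_def)
  have r2: "g z = r z * r z" if "z \<in> ball 0 1" for z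
    using l[OF that] by (simp add: r_def flip: exp_add)
  have neg: "r z + r w \<noteq> 0" if "z \<in> ball 0 1" "w \<in> ball 0 1" for z w
  proof
    assume "r z + r w = 0"
    then have eq: "r z = - r w" by (simp add: add_eq_0_iff)
    then have "g z = g w" using r2 that by simp
    then have "z = w" using inj that by (auto simp: inj_on_def)
    then show False using eq r0[of w] by simp
  qed
  have "cmod (deriv M 0) \<le> 1"
  proof (rule Bieberbach_Eilenberg_univalent)
    show "M holomorphic_on ball 0 1"
      unfolding M_def r_def using neg[of _ 0, unfolded r_def] by (intro holomorphic_intros hol) auto
    show "M 0 = 0" by (simp add: M_def)
    show "inj_on M (ball 0 1)"
    proof (rule inj_onI)
      fix z w assume zw: "z \<in> ball 0 1" "w \<in> ball 0 1" "M z = M w"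
      then have "(r z - r 0) * (r w + r 0) = (r w - r 0) * (r z + r 0)"
        using neg[of z 0] neg[of w 0] by (simp add: M_def frac_eq_eq)
      then have "2 * r 0 * (r z - r w) = 0" by (simp add: algebra_simps)
      then have "g z = g w" using r0 r2 zw by simp
      then show "z = w" using inj zw by (auto simp: inj_on_def)
    qed
    show "M z * M w \<noteq> 1" if "z \<in> ball 0 1" "w \<in> ball 0 1" for z w
    proof
      assume "M z * M w = 1"
      then have "(r z - r 0) * (r w - r 0) = (r z + r 0) * (r w + r 0)"
        using neg[of z 0] neg[of w 0] that by (simp add: M_def divide_eq_1_iff)
      then have "2 * r 0 * (r z + r w) = 0" by (simp add: algebra_simps)
      then show False using neg that r0 by simp
    qed
  qed
  moreover have l': "(l has_field_derivative deriv l 0) (at 0)"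
    using hol by (intro holomorphic_derivI[of _ "ball 0 1"]) auto
  have r': "(r has_field_derivative r 0 * (deriv l 0 / 2)) (at 0)"
    unfolding r_def by (auto intro!: derivative_eq_intros l')
  have "(M has_field_derivative deriv l 0 / 4) (at 0)"
    unfolding M_def
    by (rule derivative_eq_intros r' refl)+ (use r0[of 0] in \<open>simp_all add: field_simps\<close>)
  then have "deriv M 0 = deriv l 0 / 4"
    by (rule DERIV_imp_deriv)
  moreover have "deriv g 0 = g 0 * deriv l 0"
  proof (rule DERIV_imp_deriv)
    have "((\<lambda>z. exp (l z)) has_field_derivative g 0 * deriv l 0) (at 0)"
      using l[of 0] by (auto intro!: derivative_eq_intros l')
    then show "(g has_field_derivative g 0 * deriv l 0) (at 0)"
      by (rule DERIV_cong_ev[THEN iffD1, rotated -1, OF _ refl _ refl])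
        (use l in \<open>auto intro!: eventually_nhds_in_open[of "ball 0 1", THEN eventually_mono]\<close>)
  qed
  ultimately show ?thesis
    using mult_left_mono[of "cmod (deriv l 0)" 4 "cmod (g 0)"] by (simp add: norm_mult norm_divide mult.commute)
qed

lemma Moebius_inverse:
  assumes "cmod w < 1" "cmod z < 1"
  shows "Moebius_function 0 w (Moebius_function 0 (- w) z) = z"
    "Moebius_function 0 (- w) (Moebius_function 0 w z) = z"
  by (rule Moebius_function_compose; use assms in simp)+

text \<open>
  The component of the complement of \<open>closure T\<close> containing the image of \<open>H\<close> is simply connected,
  because its own complement is connected and unbounded. A Riemann map \<open>k\<close> of this domain with \<open>k 0 = H 0\<close>
  has no zeros, so Koebe's estimate applies to it, and \<open>H = k \<circ> \<phi>\<close> for a self-map \<open>\<phi>\<close> of the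
  disc that fixes \<open>0\<close>.
\<close>

lemma zero_free_derivative_bound:
  assumes holH: "H holomorphic_on ball 0 1"
    and T: "connected T" "\<not> bounded T" "0 \<in> T" "H ` ball 0 1 \<inter> T = {}"
  shows "cmod (deriv H 0) \<le> 4 * cmod (H 0)"
proof (cases "H constant_on ball 0 1")
  case True
  then obtain c where c: "\<And>z. z \<in> ball 0 1 \<Longrightarrow> H z = c" unfolding constant_on_def by blast
  have "(H has_field_derivative 0) (at 0)"
    by (rule has_field_derivative_transform_within_open[OF DERIV_const[where k = c], where S = "ball 0 1"]) (use c in auto)
  then show ?thesis by (simp add: DERIV_imp_deriv)
next
  case False
  have "open (H ` ball 0 1)"
    using open_mapping_thm[OF holH _ _ _ _ False] by simp
  then have "H ` ball 0 1 \<inter> closure T = {}"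
    using T(4) by (simp add: open_Int_closure_eq_empty)
  then have HT: "H ` ball 0 1 \<subseteq> - closure T"
    by (simp add: disjoint_eq_subset_Compl)
  define W where "W = connected_component_set (- closure T) (H 0)"
  have comp: "W \<in> components (- closure T)"
    unfolding W_def using HT by (intro componentsI) (simp add: image_subset_iff)
  have "open W"
    by (rule open_components[OF _ comp]) (simp add: open_Compl)
  have conn: "connected (- W)"
    using component_complement_connected[OF connected_imp_connected_closure[OF T(1)] comp] .
  have TW: "T \<subseteq> - W"
    using in_components_subset[OF comp] closure_subset by blast
  have "simply_connected W"
    unfolding simply_connected_eq_unbounded_complement_components[OF \<open>open W\<close>]
  proof (intro conjI ballI)
    show "connected W" using comp in_components_connected by blast
    fix C assume "C \<in> components (- W)"
    moreover have "- W \<noteq> {}" using TW T(3) by auto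
    ultimately have "C = - W"
      using conn components_eq_sing_iff[of "- W"] by simp
    then show "\<not> bounded C" using TW T(2) bounded_subset by blast
  qed
  moreover have "W \<noteq> {}" using comp in_components_nonempty by blast
  moreover have "W \<noteq> UNIV" using TW T(3) by auto
  ultimately obtain f g where f: "f holomorphic_on W" "\<And>z. z \<in> W \<Longrightarrow> f z \<in> ball 0 1 \<and> g (f z) = z"
    and g: "g holomorphic_on ball 0 1" "\<And>z. z \<in> ball 0 1 \<Longrightarrow> g z \<in> W \<and> f (g z) = z"
    using Riemann_mapping_theorem[of W, THEN iffD1] \<open>open W\<close> by blast
  have HW: "H ` ball 0 1 \<subseteq> W"
    unfolding W_def
    by (rule connected_component_maximal[OF _ connected_continuous_image HT])
       (auto intro: holomorphic_on_imp_continuous_on[OF holH])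
  have HWz: "H z \<in> W" if "z \<in> ball 0 1" for z
    using HW that by (simp add: image_subset_iff)
  define p where "p = f (H 0)"
  have p: "cmod p < 1" using f(2)[OF HWz, of 0] by (simp add: p_def)
  define k where "k = g \<circ> Moebius_function 0 (- p)"
  define \<phi> where "\<phi> = Moebius_function 0 p \<circ> (f \<circ> H)"
  have mobz: "Moebius_function 0 (- p) z \<in> ball 0 1" if "z \<in> ball 0 1" for z
    using p that Moebius_function_norm_lt_1[of "- p" z] by simp
  then have mob: "Moebius_function 0 (- p) ` ball 0 1 \<subseteq> ball 0 1"
    by (rule image_subsetI)
  have holk: "k holomorphic_on ball 0 1"
    unfolding k_def by (rule holomorphic_on_compose_gen[OF Moebius_function_holomorphic g(1) mob]) (simp add: p)
  have hol\<phi>: "\<phi> holomorphic_on ball 0 1"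
    unfolding \<phi>_def
  proof (rule holomorphic_on_compose_gen[OF holomorphic_on_compose_gen[OF holH f(1) HW] Moebius_function_holomorphic[OF p]])
    show "(f \<circ> H) ` ball 0 1 \<subseteq> ball 0 1"
      using f(2)[OF HWz] by (auto simp del: mem_ball_0)
  qed
  have \<phi>0: "\<phi> 0 = 0" by (simp add: \<phi>_def p_def Moebius_function_eq_zero)
  have \<phi>1: "cmod (\<phi> z) < 1" if "cmod z < 1" for z
    unfolding \<phi>_def o_def
  proof (rule Moebius_function_norm_lt_1[OF p])
    have "H z \<in> W" using HWz that by simp
    then show "cmod (f (H z)) < 1" using f(2)[of "H z"] by simp
  qed
  have Hk: "H z = k (\<phi> z)" if "z \<in> ball 0 1" for z
  proof -
    have "H z \<in> W" using HWz that by simp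
    then have "f (H z) \<in> ball 0 1" "g (f (H z)) = H z" using f(2) by blast+
    then show ?thesis using p by (simp add: k_def \<phi>_def Moebius_inverse)
  qed
  have "cmod (deriv k 0) \<le> 4 * cmod (k 0)"
  proof (rule Koebe_zero_free[OF holk])
    show "inj_on k (ball 0 1)"
    proof (rule inj_onI)
      fix z w assume zw: "z \<in> ball 0 1" "w \<in> ball 0 1" "k z = k w"
      then have "Moebius_function 0 (- p) z = Moebius_function 0 (- p) w"
        using g(2)[OF mobz[OF zw(1)]] g(2)[OF mobz[OF zw(2)]] unfolding k_def o_def by metis
      then have "Moebius_function 0 p (Moebius_function 0 (- p) z) = Moebius_function 0 p (Moebius_function 0 (- p) w)"
        by (rule arg_cong)
      then show "z = w"
        using zw(1,2) by (simp only: Moebius_inverse(1) p mem_ball_0)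
    qed
    show "k z \<noteq> 0" if "z \<in> ball 0 1" for z
    proof -
      have "k z \<in> W" using g(2)[OF mobz[OF that]] unfolding k_def o_def by simp
      then show ?thesis using TW T(3) by auto
    qed
  qed
  moreover have "cmod (deriv \<phi> 0) \<le> 1"
    using Schwarz_Lemma(2)[OF hol\<phi> \<phi>0 \<phi>1, of 0] by simp
  moreover have "deriv H 0 = deriv k 0 * deriv \<phi> 0"
  proof (rule DERIV_imp_deriv)
    have "(\<phi> has_field_derivative deriv \<phi> 0) (at 0)" "(k has_field_derivative deriv k 0) (at (\<phi> 0))"
      using holomorphic_derivI[OF hol\<phi> open_ball, of 0] holomorphic_derivI[OF holk open_ball, of 0] \<phi>0 by simp_all
    then have "((\<lambda>z. k (\<phi> z)) has_field_derivative deriv k 0 * deriv \<phi> 0) (at 0)"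
      by (rule DERIV_chain2[rotated])
    then show "(H has_field_derivative deriv k 0 * deriv \<phi> 0) (at 0)"
      by (rule has_field_derivative_transform_within_open[of _ _ _ "ball 0 1"]) (auto simp: Hk)
  qed
  moreover have "H 0 = k 0" using Hk[of 0] \<phi>0 by simp
  ultimately show ?thesis
    using mult_mono[of "cmod (deriv k 0)" "4 * cmod (k 0)" "cmod (deriv \<phi> 0)" 1]
    by (simp add: norm_mult)
qed

lemma zero_free_derivative_bound_at:
  assumes holH: "H holomorphic_on ball 0 1"
    and T: "connected T" "\<not> bounded T" "0 \<in> T" "H ` ball 0 1 \<inter> T = {}" and z: "cmod z < 1"
  shows "cmod (deriv H z) * (1 - (cmod z)\<^sup>2) \<le> 4 * cmod (H z)"
proof -
  let ?m = "Moebius_function 0 (- z)"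
  have m: "?m holomorphic_on ball 0 1" "?m ` ball 0 1 \<subseteq> ball 0 1"
    using z Moebius_function_norm_lt_1[of "- z"] by (auto intro: Moebius_function_holomorphic)
  have m0: "?m 0 = z" by (simp add: Moebius_function_of_zero)
  have "cmod (deriv (H \<circ> ?m) 0) \<le> 4 * cmod ((H \<circ> ?m) 0)"
  proof (rule zero_free_derivative_bound[OF holomorphic_on_compose_gen[OF m(1) holH m(2)] T(1-3)])
    show "(H \<circ> ?m) ` ball 0 1 \<inter> T = {}"
      using T(4) image_mono[OF m(2), of H] by (auto simp: image_comp)
  qed
  moreover have "deriv (H \<circ> ?m) 0 = deriv H z * complex_of_real (1 - (cmod z)\<^sup>2)"
  proof (rule DERIV_imp_deriv, rule DERIV_chain)
    show "(H has_field_derivative deriv H z) (at (?m 0))"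
      unfolding m0 using holH z by (auto intro!: holomorphic_derivI[of _ "ball 0 1"])
    show "(?m has_field_derivative complex_of_real (1 - (cmod z)\<^sup>2)) (at 0)"
      unfolding Moebius_function_simple[abs_def]
      by (rule derivative_eq_intros refl)+ (simp_all add: complex_norm_square del: of_real_power)
  qed
  moreover have "cmod (complex_of_real (1 - (cmod z)\<^sup>2)) = 1 - (cmod z)\<^sup>2"
    using z by (simp only: norm_of_real) (simp add: power_le_one)
  ultimately show ?thesis by (simp only: norm_mult m0 o_def)
qed

section \<open>Lower bounds for the Poincare distance\<close>

text \<open>
  \<open>log |H|\<close> grows along \<open>\<gamma>\<close> at most at the rate
  \<open>4 |\<gamma>'| / (1 - |\<gamma>|\<^sup>2)\<close>, twice the Poincare speed.
\<close>

lemma poincare_length_lower_bound: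
  assumes holH: "H holomorphic_on ball 0 1"
    and T: "connected T" "\<not> bounded T" "0 \<in> T" "H ` ball 0 1 \<inter> T = {}"
    and \<gamma>: "\<gamma> C1_differentiable_on {0..1}" "path_image \<gamma> \<subseteq> ball 0 1"
  shows "ln (cmod (H (pathfinish \<gamma>)) / cmod (H (pathstart \<gamma>))) / 2 \<le> poincare_length \<gamma>"
proof -
  have nz: "H z \<noteq> 0" if "z \<in> ball 0 1" for z
  proof
    assume "H z = 0"
    then have "0 \<in> H ` ball 0 1 \<inter> T"
      using T(3) that by (metis IntI imageI)
    then show False using T(4) by simp
  qed
  obtain l where hol: "l holomorphic_on ball 0 1" and l: "\<And>z. z \<in> ball 0 1 \<Longrightarrow> H z = exp (l z)"
    using contractible_imp_holomorphic_log[OF holH convex_imp_contractible[OF convex_ball] nz] by metis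
  have bound: "cmod (deriv l z) \<le> 4 / (1 - (cmod z)\<^sup>2)" if z: "z \<in> ball 0 1" for z
  proof -
    have pos: "1 - (cmod z)\<^sup>2 > 0" using z by (simp add: power_less_one_iff)
    have "deriv H z = H z * deriv l z"
    proof (rule DERIV_imp_deriv)
      have "((\<lambda>z. exp (l z)) has_field_derivative H z * deriv l z) (at z)"
        using l[OF z] z hol by (auto intro!: derivative_eq_intros holomorphic_derivI[of _ "ball 0 1"])
      then show "(H has_field_derivative H z * deriv l z) (at z)"
        by (rule has_field_derivative_transform_within_open[of _ _ _ "ball 0 1"]) (use z l in auto)
    qed
    then have "cmod (H z) * (cmod (deriv l z) * (1 - (cmod z)\<^sup>2)) \<le> cmod (H z) * 4"
      using zero_free_derivative_bound_at[OF holH T, of z] z by (simp add: norm_mult mult_ac)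
    then have "cmod (deriv l z) * (1 - (cmod z)\<^sup>2) \<le> 4"
      using nz[OF z] by simp
    then show ?thesis using pos by (simp add: pos_le_divide_eq)
  qed
  have \<gamma>b: "\<gamma> t \<in> ball 0 1" if "t \<in> {0..1}" for t
    using \<gamma>(2) that unfolding path_image_def by blast
  have \<gamma>d: "(\<gamma> has_vector_derivative vector_derivative \<gamma> (at t)) (at t)" if "t \<in> {0..1}" for t
    using \<gamma>(1) that by (auto simp: C1_differentiable_on_eq vector_derivative_works)
  have cont\<gamma>': "continuous_on {0..1} (\<lambda>t. vector_derivative \<gamma> (at t))"
    using \<gamma>(1) by (simp add: C1_differentiable_on_eq)
  have cont\<gamma>: "continuous_on {0..1} \<gamma>"
    using \<gamma>(1) C1_differentiable_imp_continuous_on by blast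
  have "deriv l holomorphic_on ball 0 1" using hol by (simp add: holomorphic_deriv)
  then have contl: "continuous_on {0..1} (\<lambda>t. deriv l (\<gamma> t))"
    using continuous_on_compose2[OF holomorphic_on_imp_continuous_on cont\<gamma>] \<gamma>b by blast
  let ?v = "\<lambda>t. vector_derivative \<gamma> (at t)"
  have "((\<lambda>t. Re (?v t * deriv l (\<gamma> t))) has_integral Re (l (\<gamma> 1)) - Re (l (\<gamma> 0))) {0..1}"
  proof (rule fundamental_theorem_of_calculus)
    fix t :: real assume t: "t \<in> {0..1}"
    have "(l has_field_derivative deriv l (\<gamma> t)) (at (\<gamma> t))"
      using hol \<gamma>b[OF t] by (intro holomorphic_derivI[of _ "ball 0 1"]) auto
    then have "(l \<circ> \<gamma> has_vector_derivative ?v t * deriv l (\<gamma> t)) (at t)"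
      using field_vector_diff_chain_at[OF \<gamma>d[OF t]] by blast
    then have "((\<lambda>t. Re ((l \<circ> \<gamma>) t)) has_vector_derivative Re (?v t * deriv l (\<gamma> t))) (at t)"
      by (rule bounded_linear.has_vector_derivative[OF bounded_linear_Re])
    then show "((\<lambda>t. Re (l (\<gamma> t))) has_vector_derivative Re (?v t * deriv l (\<gamma> t))) (at t within {0..1})"
      by (simp add: o_def has_vector_derivative_at_within)
  qed simp
  moreover have "poincare_length \<gamma> = integral {0..1} (\<lambda>t. 2 * cmod (?v t) / (1 - (cmod (\<gamma> t))\<^sup>2))"
    by (simp add: poincare_length_def)
  moreover have "(\<lambda>t. 2 * cmod (?v t) / (1 - (cmod (\<gamma> t))\<^sup>2)) integrable_on {0..1}"
  proof (rule integrable_continuous_interval, intro continuous_intros cont\<gamma> cont\<gamma>')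
    show "\<forall>t\<in>{0..1}. 1 - (cmod (\<gamma> t))\<^sup>2 \<noteq> 0"
    proof
      fix t :: real assume "t \<in> {0..1}"
      then have "cmod (\<gamma> t) < 1" using \<gamma>b by simp
      then show "1 - (cmod (\<gamma> t))\<^sup>2 \<noteq> 0"
        using power_strict_mono[of "cmod (\<gamma> t)" 1 2] by simp
    qed
  qed
  ultimately have "((\<lambda>t. Re (?v t * deriv l (\<gamma> t)) / 2) has_integral (Re (l (\<gamma> 1)) - Re (l (\<gamma> 0))) / 2) {0..1}"
    "((\<lambda>t. 2 * cmod (?v t) / (1 - (cmod (\<gamma> t))\<^sup>2)) has_integral poincare_length \<gamma>) {0..1}"
    by (auto intro: has_integral_divide simp: integrable_integral)
  then have "(Re (l (\<gamma> 1)) - Re (l (\<gamma> 0))) / 2 \<le> poincare_length \<gamma>"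
  proof (rule has_integral_le)
    fix t :: real assume t: "t \<in> {0..1}"
    have "Re (?v t * deriv l (\<gamma> t)) \<le> cmod (?v t) * cmod (deriv l (\<gamma> t))"
      using complex_Re_le_cmod[of "?v t * deriv l (\<gamma> t)"] by (simp add: norm_mult)
    also have "\<dots> \<le> cmod (?v t) * (4 / (1 - (cmod (\<gamma> t))\<^sup>2))"
      by (intro mult_left_mono bound \<gamma>b t) auto
    finally show "Re (?v t * deriv l (\<gamma> t)) / 2 \<le> 2 * cmod (?v t) / (1 - (cmod (\<gamma> t))\<^sup>2)"
      by (simp add: mult.commute)
  qed
  moreover have "ln (cmod (H (\<gamma> 1)) / cmod (H (\<gamma> 0))) = Re (l (\<gamma> 1)) - Re (l (\<gamma> 0))"
    using l[OF \<gamma>b, of 0] l[OF \<gamma>b, of 1] by (simp add: ln_div)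
  ultimately show ?thesis
    by (simp add: pathstart_def pathfinish_def)
qed

lemma poincare_dist_disc_lower_bound:
  assumes holH: "H holomorphic_on ball 0 1"
    and T: "connected T" "\<not> bounded T" "0 \<in> T" "H ` ball 0 1 \<inter> T = {}"
    and ab: "a \<in> ball 0 1" "b \<in> ball 0 1"
  shows "ln (cmod (H b) / cmod (H a)) / 2 \<le> poincare_dist_disc a b"
  unfolding poincare_dist_disc_def
proof (rule cInf_greatest)
  have "linepath a b C1_differentiable_on {0..1}"
    by (auto simp: C1_differentiable_on_eq)
  moreover have "path_image (linepath a b) \<subseteq> ball 0 1"
    using ab by (simp add: closed_segment_subset)
  ultimately show "{poincare_length \<gamma> |\<gamma>. \<gamma> C1_differentiable_on {0..1} \<and> path_image \<gamma> \<subseteq> ball 0 1 \<and>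
     pathstart \<gamma> = a \<and> pathfinish \<gamma> = b} \<noteq> {}"
    by (auto intro!: exI[of _ "linepath a b"])
  fix x
  assume "x \<in> {poincare_length \<gamma> |\<gamma>. \<gamma> C1_differentiable_on {0..1} \<and> path_image \<gamma> \<subseteq> ball 0 1 \<and>
     pathstart \<gamma> = a \<and> pathfinish \<gamma> = b}"
  then show "ln (cmod (H b) / cmod (H a)) / 2 \<le> x"
    using poincare_length_lower_bound[OF holH T] by blast
qed

section \<open>A connected union of discs\<close>

text \<open>
  Points of the plane that are pairwise at an angle of at most \<open>\<pi>/2\<close> have arguments in an
  interval of length \<open>\<pi>/2\<close>, once these are measured from one of the points, \<open>a0\<close>, so as to lie in
  \<open>[- \<pi>/2, \<pi>/2]\<close>. The rotation moves the least argument to \<open>0\<close>.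
\<close>

lemma quarter_plane_rotation:
  assumes "\<And>a b. a \<in> \<Gamma> \<Longrightarrow> b \<in> \<Gamma> \<Longrightarrow> 0 \<le> Re (cnj a * b)"
  shows "\<exists>c. c \<noteq> 0 \<and> (\<forall>a\<in>\<Gamma>. 0 \<le> Re (c * a) \<and> 0 \<le> Im (c * a))"
proof (cases "\<Gamma> \<subseteq> {0}")
  case True
  then show ?thesis by (intro exI[of _ 1]) auto
next
  case False
  then obtain a0 where a0: "a0 \<in> \<Gamma>" "a0 \<noteq> 0" by auto
  define \<theta> where "\<theta> = (\<lambda>a. Arg (a / a0))"
  have polar: "a = a0 * (of_real (cmod (a / a0)) * cis (\<theta> a))" if "a \<noteq> 0" for a
    using that a0 rcis_cmod_Arg[of "a / a0"] by (simp add: \<theta>_def rcis_def)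
  have diff: "\<theta> a - \<theta> b \<le> pi / 2" if "a \<in> \<Gamma>" "a \<noteq> 0" "b \<in> \<Gamma>" "b \<noteq> 0" and lt: "\<theta> a - \<theta> b \<le> pi" for a b
  proof (rule ccontr)
    assume "\<not> ?thesis"
    then have "0 < sin (\<theta> a - \<theta> b - pi / 2)"
      using lt by (intro sin_gt_zero) auto
    then have neg: "cos (\<theta> a - \<theta> b) < 0"
      by (simp add: sin_diff)
    have "cnj b * a = of_real ((cmod a0)\<^sup>2 * (cmod (b / a0) * cmod (a / a0))) * cis (\<theta> a - \<theta> b)"
    proof -
      have "cnj b * a = cnj (a0 * (of_real (cmod (b / a0)) * cis (\<theta> b))) * (a0 * (of_real (cmod (a / a0)) * cis (\<theta> a)))"
        using polar[OF that(2)] polar[OF that(4)] by simp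
      also have "\<dots> = (a0 * cnj a0) * of_real (cmod (b / a0) * cmod (a / a0)) * (cis (- \<theta> b) * cis (\<theta> a))"
        by (simp add: cis_cnj mult_ac)
      also have "\<dots> = of_real ((cmod a0)\<^sup>2 * (cmod (b / a0) * cmod (a / a0))) * cis (\<theta> a - \<theta> b)"
        by (simp add: cis_mult flip: complex_norm_square)
      finally show ?thesis .
    qed
    then have "Re (cnj b * a) = ((cmod a0)\<^sup>2 * (cmod (b / a0) * cmod (a / a0))) * cos (\<theta> a - \<theta> b)"
      by (simp only: scaleR_conv_of_real[symmetric] scaleR_complex.sel cis.sel)
    also have "\<dots> < 0"
      using neg a0 that by (intro mult_pos_neg mult_pos_pos) auto
    finally show False using assms[OF that(3,1)] by simp
  qed
  have \<theta>0: "\<theta> a0 = 0" using a0 by (simp add: \<theta>_def)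
  have \<theta>le: "\<theta> a \<le> pi / 2" "- (pi / 2) \<le> \<theta> a" if "a \<in> \<Gamma>" "a \<noteq> 0" for a
    using diff[OF that a0] diff[OF a0 that] Arg_bounded[of "a / a0"] \<theta>0 by (simp_all add: \<theta>_def)
  let ?T = "\<theta> ` (\<Gamma> - {0})"
  define \<phi> where "\<phi> = Inf ?T"
  have bdd: "bdd_below ?T"
    using \<theta>le(2) by (intro bdd_belowI[of _ "- (pi / 2)"]) auto
  define c where "c = cis (- \<phi>) / a0"
  have "0 \<le> Re (c * a) \<and> 0 \<le> Im (c * a)" if a: "a \<in> \<Gamma>" for a
  proof (cases "a = 0")
    case False
    have 1: "\<phi> \<le> \<theta> a"
      unfolding \<phi>_def using a False by (intro cInf_lower bdd) auto
    have "\<theta> a - pi / 2 \<le> \<phi>"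
      unfolding \<phi>_def
    proof (rule cInf_greatest)
      fix t assume "t \<in> ?T"
      then obtain b where b: "b \<in> \<Gamma>" "b \<noteq> 0" "t = \<theta> b" by auto
      have "\<theta> a - \<theta> b \<le> pi" using \<theta>le(1)[OF a False] \<theta>le(2)[OF b(1,2)] by simp
      then show "\<theta> a - pi / 2 \<le> t" using diff[OF a False b(1,2)] b(3) by simp
    qed (use a0 in auto)
    then have "0 \<le> sin (\<theta> a - \<phi>)" "0 \<le> cos (\<theta> a - \<phi>)"
      using 1 by (auto intro!: sin_ge_zero cos_ge_zero)
    moreover have "c * a = of_real (cmod (a / a0)) * cis (\<theta> a - \<phi>)"
    proof -
      have "c * a = c * (a0 * (of_real (cmod (a / a0)) * cis (\<theta> a)))"
        using polar[OF False] by simp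
      also have "\<dots> = of_real (cmod (a / a0)) * (cis (- \<phi>) * cis (\<theta> a))"
        using a0 by (simp add: c_def)
      finally show ?thesis by (simp add: cis_mult)
    qed
    ultimately show ?thesis by simp
  qed simp
  moreover have "c \<noteq> 0" using a0 by (simp add: c_def)
  ultimately show ?thesis by blast
qed

text \<open>
  A pair \<open>m = (\<alpha>, \<beta>)\<close> stands for a functional with the values \<open>\<alpha>\<close> at \<open>x\<close> and
  \<open>\<beta>\<close> at \<open>y\<close>, so that \<open>\<alpha> z - \<beta>\<close> is its value at \<open>z x - y\<close>. The form is negative where two
  functionals have values at an obtuse angle.
\<close>

definition disc_form :: "complex \<times> complex \<Rightarrow> complex \<times> complex \<Rightarrow> complex \<Rightarrow> real" where
  "disc_form m n z = Re (cnj (fst m * z - snd m) * (fst n * z - snd n))"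

text \<open>
  The form is a real quadratic polynomial in \<open>z\<close> with leading coefficient
  \<open>Re (cnj (fst m) * fst n)\<close>; if this is nonnegative, the form is convex.
\<close>

lemma disc_form_segment:
  "disc_form m n ((1 - t) *\<^sub>R z + t *\<^sub>R p) =
     (1 - t) * disc_form m n z + t * disc_form m n p
       - t * (1 - t) * ((cmod (z - p))\<^sup>2 * Re (cnj (fst m) * fst n))"
proof -
  obtain a1 a2 b1 b2 c1 c2 d1 d2 z1 z2 p1 p2 where
    "m = (Complex a1 a2, Complex b1 b2)" "n = (Complex c1 c2, Complex d1 d2)" "z = Complex z1 z2" "p = Complex p1 p2"
    by (metis complex.exhaust surj_pair)
  then show ?thesis
    unfolding disc_form_def cmod_power2
    by (simp add: algebra_simps power2_eq_square)
qed

text \<open>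
  Let the root of \<open>m = (\<alpha>, \<beta>)\<close> be \<open>\<beta> / \<alpha>\<close>. If the form of \<open>m\<close> and \<open>n\<close> is negative at \<open>z\<close>, it
  is negative at the root of \<open>m + n\<close> as well, since there the values of \<open>m\<close> and \<open>n\<close> are opposite, and by
  convexity also on the segment between these points. The roots of two members are joined by the
  roots of their convex combinations: at such a root the values of the two members are again opposite, or both
  vanish and all these roots coincide.
\<close>

lemma connected_union_of_discs:
  assumes add: "\<And>m n. m \<in> S \<Longrightarrow> n \<in> S \<Longrightarrow> m + n \<in> S"
    and fst_pos: "\<And>m n. m \<in> S \<Longrightarrow> n \<in> S \<Longrightarrow> 0 \<le> Re (cnj (fst m) * fst n)"
    and snd_pos: "\<And>m n. m \<in> S \<Longrightarrow> n \<in> S \<Longrightarrow> 0 \<le> Re (cnj (snd m) * snd n)"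
  shows "connected {z. \<exists>m\<in>S. \<exists>n\<in>S. disc_form m n z < 0}" (is "connected ?E")
proof -
  define root where "root = (\<lambda>m::complex \<times> complex. snd m / fst m)"
  have norm_sum: "(cmod (a + b))\<^sup>2 = (cmod a)\<^sup>2 + (cmod b)\<^sup>2 + 2 * Re (cnj a * b)" for a b
    unfolding cmod_power2 by (simp add: power2_eq_square algebra_simps)
  have to_root: "\<exists>m\<in>S. fst m \<noteq> 0 \<and> root m \<in> ?E \<and> connected_component ?E z (root m)" if z: "z \<in> ?E" for z
  proof -
    obtain m n where mn: "m \<in> S" "n \<in> S" "disc_form m n z < 0" using z by auto
    have nz: "fst (m + n) \<noteq> 0"
    proof
      assume "fst (m + n) = 0"
      then have "(cmod (fst m))\<^sup>2 + (cmod (fst n))\<^sup>2 + 2 * Re (cnj (fst m) * fst n) = 0"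
        using norm_sum[of "fst m" "fst n"] by simp
      then have "fst m = 0" "fst n = 0"
        using fst_pos[OF mn(1,2)] by (smt (verit) norm_eq_zero zero_le_power2 zero_less_power2)+
      then show False using mn snd_pos[OF mn(1,2)] by (simp add: disc_form_def)
    qed
    define p where "p = root (m + n)"
    define B where "B = fst m * p - snd m"
    have B': "fst n * p - snd n = - B"
    proof -
      have "fst (m + n) * p = snd (m + n)" using nz by (simp add: p_def root_def)
      then show ?thesis by (simp add: B_def algebra_simps)
    qed
    have "B \<noteq> 0"
    proof
      assume "B = 0"
      then have eqs: "snd m = fst m * p" "snd n = fst n * p" using B' by (simp_all add: B_def)
      have "disc_form m n z = (cmod (z - p))\<^sup>2 * Re (cnj (fst m) * fst n)"
      proof -
        have "cnj (fst m * z - fst m * p) * (fst n * z - fst n * p) = ((z - p) * cnj (z - p)) * (cnj (fst m) * fst n)"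
          by (simp add: algebra_simps)
        then show ?thesis unfolding disc_form_def eqs complex_norm_square[symmetric] by simp
      qed
      then show False using mn fst_pos[OF mn(1,2)] by (simp add: mult_less_0_iff)
    qed
    then have pneg: "disc_form m n p < 0"
    proof -
      have "disc_form m n p = - (cmod B)\<^sup>2"
        unfolding disc_form_def B' B_def[symmetric] cmod_power2 by (simp add: power2_eq_square)
      then show ?thesis using \<open>B \<noteq> 0\<close> by simp
    qed
    have "closed_segment z p \<subseteq> ?E"
    proof
      fix w assume "w \<in> closed_segment z p"
      then obtain t where t: "0 \<le> t" "t \<le> 1" "w = (1 - t) *\<^sub>R z + t *\<^sub>R p"
        by (auto simp: closed_segment_def)
      have "0 \<le> t * (1 - t) * ((cmod (z - p))\<^sup>2 * Re (cnj (fst m) * fst n))"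
        using t fst_pos[OF mn(1,2)] by simp
      moreover have "(1 - t) * disc_form m n z + t * disc_form m n p < 0"
        using convex_bound_lt[OF mn(3) pneg, of "1 - t" t] t by simp
      ultimately have "disc_form m n w < 0"
        unfolding t(3) disc_form_segment by linarith
      then show "w \<in> ?E" using mn by blast
    qed
    then have "connected_component ?E z p"
      unfolding connected_component_def by (intro exI[of _ "closed_segment z p"]) auto
    moreover have "p \<in> ?E" using pneg mn by blast
    ultimately show ?thesis using add[OF mn(1,2)] nz unfolding p_def by blast
  qed
  have roots: "connected_component ?E (root m) (root n)"
    if m: "m \<in> S" "fst m \<noteq> 0" "root m \<in> ?E" and n: "n \<in> S" "fst n \<noteq> 0" "root n \<in> ?E" for m n
  proof -
    define k where "k = (\<lambda>t::real. (1 - t) *\<^sub>R m + t *\<^sub>R n)"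
    have nz: "fst (k t) \<noteq> 0" if t: "t \<in> {0..1}" for t
    proof
      assume "fst (k t) = 0"
      then have "(cmod ((1 - t) *\<^sub>R fst m + t *\<^sub>R fst n))\<^sup>2 = 0" by (simp add: k_def)
      then have "((1 - t) * cmod (fst m))\<^sup>2 + (t * cmod (fst n))\<^sup>2 + 2 * ((1 - t) * t * Re (cnj (fst m) * fst n)) = 0"
      proof -
        have "cmod ((1 - t) *\<^sub>R fst m) = (1 - t) * cmod (fst m)" "cmod (t *\<^sub>R fst n) = t * cmod (fst n)"
          using t by simp_all
        moreover have "Re (cnj ((1 - t) *\<^sub>R fst m) * t *\<^sub>R fst n) = (1 - t) * t * Re (cnj (fst m) * fst n)"
          by (simp add: algebra_simps)
        ultimately show ?thesis
          using \<open>(cmod ((1 - t) *\<^sub>R fst m + t *\<^sub>R fst n))\<^sup>2 = 0\<close> by (simp only: norm_sum)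
      qed
      moreover have "0 \<le> (1 - t) * t * Re (cnj (fst m) * fst n)"
        using t fst_pos[OF m(1) n(1)] by simp
      ultimately have "(1 - t) * cmod (fst m) = 0" "t * cmod (fst n) = 0"
        by (smt (verit) zero_le_power2 zero_less_power2)+
      then show False using m(2) n(2) by simp
    qed
    have "continuous_on {0..1} (\<lambda>t. root (k t))"
      unfolding root_def using nz by (auto intro!: continuous_intros simp: k_def)
    then have "connected ((\<lambda>t. root (k t)) ` {0..1})"
      by (intro connected_continuous_image) auto
    moreover have "(\<lambda>t. root (k t)) ` {0..1} \<subseteq> ?E"
    proof (rule image_subsetI)
      fix t :: real assume t: "t \<in> {0..1}"
      define p where "p = root (k t)"
      have eq: "(1 - t) *\<^sub>R (fst m * p - snd m) + t *\<^sub>R (fst n * p - snd n) = 0"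
      proof -
        have "fst (k t) * p = snd (k t)" using nz[OF t] by (simp add: p_def root_def)
        then show ?thesis by (simp add: k_def scaleR_conv_of_real algebra_simps)
      qed
      consider "t = 0" | "t = 1" | "0 < t" "t < 1" using t by fastforce
      then show "root (k t) \<in> ?E"
      proof cases
        case 3
        show ?thesis
        proof (cases "fst m * p - snd m = 0")
          case True
          then have "p = root m" using m(2) by (simp add: root_def field_simps)
          then show ?thesis using m(3) by (simp add: p_def)
        next
          case False
          define B where "B = fst m * p - snd m"
          have "t *\<^sub>R (fst n * p - snd n) = - ((1 - t) *\<^sub>R B)"
            using eq unfolding B_def by (simp add: add_eq_0_iff)
          moreover have "fst n * p - snd n = inverse t *\<^sub>R (t *\<^sub>R (fst n * p - snd n))"
            using 3 by simp
          ultimately have eqB: "fst n * p - snd n = (- (inverse t * (1 - t))) *\<^sub>R B"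
            by (metis scaleR_minus_left scaleR_minus_right scaleR_scaleR)
          have "disc_form m n p = Re (cnj B * ((- (inverse t * (1 - t))) *\<^sub>R B))"
            by (simp only: disc_form_def eqB B_def)
          also have "\<dots> = (- (inverse t * (1 - t))) * (cmod B)\<^sup>2"
            unfolding cmod_power2 by (simp add: power2_eq_square algebra_simps)
          also have "\<dots> < 0"
            using 3 False by (intro mult_neg_pos) (auto simp: B_def)
          finally show ?thesis using m(1) n(1) by (auto simp: p_def)
        qed
      qed (use m(3) n(3) in \<open>simp_all add: k_def\<close>)
    qed
    moreover have "root m \<in> (\<lambda>t. root (k t)) ` {0..1}" "root n \<in> (\<lambda>t. root (k t)) ` {0..1}"
      using imageI[of 0 "{0..1}" "\<lambda>t. root (k t)"] imageI[of 1 "{0..1}" "\<lambda>t. root (k t)"] by (simp_all add: k_def)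
    ultimately show ?thesis unfolding connected_component_def by blast
  qed
  show ?thesis
    unfolding connected_iff_connected_component
  proof (intro ballI)
    fix z w assume "z \<in> ?E" "w \<in> ?E"
    then show "connected_component ?E z w"
      using to_root roots by (meson connected_component_sym connected_component_trans)
  qed
qed

section \<open>The complement of L as a union of discs\<close>

lemma bounded_linear_scaleC_right: "bounded_linear (\<lambda>x::'a::complex_banach. c *\<^sub>C x)"
proof (rule bounded_linear_intro[where K = "cmod c"])
  show "c *\<^sub>C (r *\<^sub>R x) = r *\<^sub>R (c *\<^sub>C x)" for r and x :: 'a
    by (simp add: scaleC_scaleC mult.commute flip: scaleC_of_real)
qed (simp_all add: scaleC_add_right norm_scaleC mult.commute)

lemma bounded_linear_scaleC_left: "bounded_linear (\<lambda>c. c *\<^sub>C (x::'a::complex_banach))"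
proof (rule bounded_linear_intro[where K = "norm x"])
  show "(r *\<^sub>R c) *\<^sub>C x = r *\<^sub>R (c *\<^sub>C x)" for r c
    by (simp add: scaleC_scaleC scaleR_conv_of_real flip: scaleC_of_real)
qed (simp_all add: scaleC_add_left norm_scaleC)

lemma scaleC_minus_left: "(- c) *\<^sub>C x = - (c *\<^sub>C (x::'a::complex_banach))"
  using linear_neg[OF bounded_linear.linear[OF bounded_linear_scaleC_left[of x]]] by simp

text \<open>
  Take for \<open>P\<close> the closure of \<open>R - \<i>R\<close>. As \<open>R + \<i>R = \<i> (R - \<i>R)\<close>, condition (C1) reads
  \<open>R = P \<inter> \<i>P\<close>, which replaces \<open>R\<close> by a single closed convex cone.
\<close>

lemma cond_C1_half_space_cone:
  fixes R C :: "'a::complex_banach set"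
  assumes R: "closed_convex_cone R" and C1: "cond_C1 R C"
  obtains P where "closed P" "convex P" "0 \<in> P" "\<And>t u. t > 0 \<Longrightarrow> u \<in> P \<Longrightarrow> t *\<^sub>R u \<in> P"
    "\<And>u. u \<in> R \<longleftrightarrow> u \<in> P \<and> (- \<i>) *\<^sub>C u \<in> P"
proof -
  define A where "A = {u - \<i> *\<^sub>C v | u v. u \<in> R \<and> v \<in> R}"
  define B where "B = {u + \<i> *\<^sub>C v | u v. u \<in> R \<and> v \<in> R}"
  have Radd: "u + v \<in> R" if "u \<in> R" "v \<in> R" for u v
    using R that by (simp add: closed_convex_cone_def)
  have Rscale: "t *\<^sub>R u \<in> R" if "0 < t" "u \<in> R" for t u
    using R that by (simp add: closed_convex_cone_def)
  have ii: "\<i> *\<^sub>C (\<i> *\<^sub>C v) = - v" "(- \<i>) *\<^sub>C (\<i> *\<^sub>C v) = v" for v :: 'a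
    by (simp_all add: scaleC_scaleC scaleC_minus_left scaleC_one)
  have Ascale: "t *\<^sub>R w \<in> A" if t: "0 < t" and w: "w \<in> A" for t w
  proof -
    obtain u v where uv: "w = u - \<i> *\<^sub>C v" "u \<in> R" "v \<in> R"
      using w by (auto simp: A_def)
    have "t *\<^sub>R w = t *\<^sub>R u - \<i> *\<^sub>C (t *\<^sub>R v)"
      using uv by (simp add: scaleR_diff_right linear_cmul[OF bounded_linear.linear[OF bounded_linear_scaleC_right]])
    then show ?thesis using Rscale[OF t] uv(2,3) unfolding A_def by blast
  qed
  have Aadd: "w + w' \<in> A" if w: "w \<in> A" "w' \<in> A" for w w'
  proof -
    obtain u v u' v' where uv: "w = u - \<i> *\<^sub>C v" "u \<in> R" "v \<in> R" "w' = u' - \<i> *\<^sub>C v'" "u' \<in> R" "v' \<in> R"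
      using w by (auto simp: A_def)
    have "w + w' = (u + u') - \<i> *\<^sub>C (v + v')"
      using uv by (simp add: scaleC_add_right)
    then show ?thesis using Radd uv unfolding A_def by blast
  qed
  have "convex A"
    unfolding convex_alt
  proof (intro ballI allI impI)
    fix w w' and t :: real assume "w \<in> A" "w' \<in> A" "0 \<le> t \<and> t \<le> 1"
    then show "(1 - t) *\<^sub>R w + t *\<^sub>R w' \<in> A"
      using Aadd Ascale by (cases "t = 0 \<or> t = 1") auto
  qed
  have iA: "(\<lambda>w. (- \<i>) *\<^sub>C w) ` B = A"
  proof -
    have "(- \<i>) *\<^sub>C (u + \<i> *\<^sub>C v) = v - \<i> *\<^sub>C u" for u v :: 'a
      by (simp add: scaleC_add_right ii(1) scaleC_minus_left)
    then show ?thesis unfolding A_def B_def by (auto simp: image_iff) metis+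
  qed
  have clB: "w \<in> closure B \<longleftrightarrow> (- \<i>) *\<^sub>C w \<in> closure A" for w
  proof
    assume "w \<in> closure B"
    then show "(- \<i>) *\<^sub>C w \<in> closure A"
      using closure_bounded_linear_image_subset[OF bounded_linear_scaleC_right[of "- \<i>"], of B]
      unfolding iA by blast
  next
    assume w: "(- \<i>) *\<^sub>C w \<in> closure A"
    have "(\<lambda>w. \<i> *\<^sub>C w) ` A = B"
      unfolding iA[symmetric] image_comp o_def by (simp add: scaleC_scaleC scaleC_one)
    then have "\<i> *\<^sub>C ((- \<i>) *\<^sub>C w) \<in> closure B"
      using closure_bounded_linear_image_subset[OF bounded_linear_scaleC_right[of "\<i>"], of A] w by blast
    then show "w \<in> closure B" by (simp add: scaleC_scaleC scaleC_one)
  qed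
  have RAB: "closure B \<inter> closure A = R"
    using C1 by (simp add: cond_C1_def A_def B_def)
  have "0 \<in> R"
  proof -
    obtain u where "u \<in> R" using R by (auto simp: closed_convex_cone_def)
    then have 1: "inverse (real (Suc n)) *\<^sub>R u \<in> R" for n using Rscale by simp
    have 2: "(\<lambda>n. inverse (real (Suc n)) *\<^sub>R u) \<longlonglongrightarrow> 0 *\<^sub>R u"
      by (intro tendsto_intros LIMSEQ_inverse_real_of_nat)
    have "closed R" using R by (simp add: closed_convex_cone_def)
    from closed_sequentially[OF this 1 2] show ?thesis by simp
  qed
  show ?thesis
  proof (rule that[of "closure A"])
    show "convex (closure A)" using \<open>convex A\<close> by (rule convex_closure)
    show "0 \<in> closure A" using \<open>0 \<in> R\<close> RAB by blast
    show "t *\<^sub>R u \<in> closure A" if "t > 0" "u \<in> closure A" for t u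
    proof -
      have "t *\<^sub>R u \<in> (*\<^sub>R) t ` closure A" using that by blast
      also have "\<dots> \<subseteq> closure A"
        unfolding closure_scaleR by (rule closure_mono) (use that Ascale in auto)
      finally show ?thesis .
    qed
    show "u \<in> R \<longleftrightarrow> u \<in> closure A \<and> (- \<i>) *\<^sub>C u \<in> closure A" for u
      using RAB clB by blast
  qed simp
qed

lemma convex_cone_separating_functional:
  fixes Q :: "(complex \<times> complex) set"
  assumes Q: "closed Q" "convex Q" "0 \<in> Q" "\<And>t q. t > 0 \<Longrightarrow> q \<in> Q \<Longrightarrow> t *\<^sub>R q \<in> Q" and p: "p \<notin> Q"
  obtains \<alpha> \<beta> where "\<And>q. q \<in> Q \<Longrightarrow> 0 \<le> Re (\<alpha> * fst q + \<beta> * snd q)" "Re (\<alpha> * fst p + \<beta> * snd p) < 0"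
proof -
  obtain a b where ab: "inner a p < b" "\<And>q. q \<in> Q \<Longrightarrow> b < inner a q"
    using separating_hyperplane_closed_point[OF Q(2,1) p] by blast
  have inner_eq: "inner a q = Re (cnj (fst a) * fst q + cnj (snd a) * snd q)" for q
    by (cases a; cases q) (simp add: inner_complex_def)
  have b: "b < 0" using ab(2)[OF Q(3)] by simp
  have "0 \<le> inner a q" if q: "q \<in> Q" for q
  proof (rule ccontr)
    assume neg: "\<not> 0 \<le> inner a q"
    define t where "t = b / inner a q"
    have "t > 0" using b neg by (simp add: t_def divide_neg_neg)
    then have "b < inner a (t *\<^sub>R q)" using ab(2) Q(4) q by blast
    then show False using neg by (simp add: t_def)
  qed
  then show ?thesis
    using that[of "cnj (fst a)" "cnj (snd a)"] ab(1) b by (simp add: inner_eq)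
qed

text \<open>
  The functionals are taken on the coefficient space of the span of \<open>x\<close> and \<open>y\<close>, where
  finite-dimensional separation is available: \<open>S\<close> is the dual cone of the preimage \<open>Q\<close> of \<open>P\<close> there. On a
  multiple of an element of \<open>R = P \<inter> \<i>P\<close> the members of \<open>S\<close> take values in a common quarter plane;
  conversely, if the values at \<open>v (z, -1) = z x - y\<close> are pairwise at an angle of at most \<open>\<pi>/2\<close>,
  a common rotation brings them into the first quadrant and separation puts the rotated vector into \<open>R\<close>.
\<close>

lemma E_set_union_of_discs:
  fixes R C :: "'a::complex_banach set"
  assumes R: "closed_convex_cone R" and C1: "cond_C1 R C" and xy: "x \<in> C" "y \<in> C"
  shows "\<exists>S. (\<forall>m\<in>S. \<forall>n\<in>S. m + n \<in> S \<and> 0 \<le> Re (cnj (fst m) * fst n) \<and> 0 \<le> Re (cnj (snd m) * snd n)) \<and>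
    E_set C x y = {z. \<exists>m\<in>S. \<exists>n\<in>S. disc_form m n z < 0}"
proof -
  obtain P where P: "closed P" "convex P" "0 \<in> P" "\<And>t u. t > 0 \<Longrightarrow> u \<in> P \<Longrightarrow> t *\<^sub>R u \<in> P"
    and RP: "\<And>u. u \<in> R \<longleftrightarrow> u \<in> P \<and> (- \<i>) *\<^sub>C u \<in> P"
    using cond_C1_half_space_cone[OF R C1] by metis
  define v where "v = (\<lambda>q::complex \<times> complex. fst q *\<^sub>C x + snd q *\<^sub>C y)"
  define f where "f = (\<lambda>m q::complex \<times> complex. fst m * fst q + snd m * snd q)"
  have v: "bounded_linear v"
    unfolding v_def
    by (intro bounded_linear_add bounded_linear_compose[OF bounded_linear_scaleC_left]
        bounded_linear_fst bounded_linear_snd)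
  define Q where "Q = v -` P"
  define S where "S = {m. \<forall>q\<in>Q. 0 \<le> Re (f m q)}"
  have Q: "closed Q" "convex Q" "0 \<in> Q" "\<And>t q. t > 0 \<Longrightarrow> q \<in> Q \<Longrightarrow> t *\<^sub>R q \<in> Q"
  proof -
    show "closed Q" unfolding Q_def by (intro continuous_closed_vimage P linear_continuous_at v)
    show "convex Q" unfolding Q_def using v P(2) by (intro convex_linear_vimage bounded_linear.linear)
    show "0 \<in> Q" using P(3) by (simp add: Q_def linear_0[OF bounded_linear.linear[OF v]])
    show "t *\<^sub>R q \<in> Q" if "t > 0" "q \<in> Q" for t q
      using that P(4) by (simp add: Q_def linear_cmul[OF bounded_linear.linear[OF v]])
  qed
  have vc: "v (c * s, c * t) = c *\<^sub>C v (s, t)" for c s t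
    by (simp add: v_def scaleC_add_right scaleC_scaleC)
  have fc: "f m (c * s, c * t) = c * f m (s, t)" for m c s t
    by (simp add: f_def algebra_simps)
  have inC: "0 \<le> Re (cnj (f m q) * f n q)" if m: "m \<in> S" and n: "n \<in> S" and q: "v q \<in> C" for m n q
  proof -
    obtain c u where cu: "v q = c *\<^sub>C u" "c \<noteq> 0" "u \<in> R" using q C1 by (auto simp: cond_C1_def)
    define p where "p = (fst q / c, snd q / c)"
    have qp: "q = (c * fst p, c * snd p)" using cu(2) by (simp add: p_def)
    have "v p = u"
    proof -
      have "v p = (1 / c) *\<^sub>C v q"
        using vc[of "1 / c" "fst q" "snd q"] by (simp add: p_def)
      then show ?thesis using cu by (simp add: scaleC_scaleC scaleC_one)
    qed
    have "p \<in> Q" "(- \<i> * fst p, - \<i> * snd p) \<in> Q"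
      using RP[of u] cu(3) vc[of "- \<i>" "fst p" "snd p"] \<open>v p = u\<close> by (simp_all add: Q_def)
    then have quad: "0 \<le> Re (f k p)" "0 \<le> Im (f k p)" if "k \<in> S" for k
      using that fc[of k "- \<i>" "fst p" "snd p"] by (force simp: S_def)+
    have fq: "f k q = c * f k p" for k
      using fc[of k c "fst p" "snd p"] qp by simp
    have "cnj (f m q) * f n q = (c * cnj c) * (cnj (f m p) * f n p)"
      by (simp add: fq)
    then have "Re (cnj (f m q) * f n q) = (cmod c)\<^sup>2 * Re (cnj (f m p) * f n p)"
      by (simp only: complex_norm_square[symmetric] scaleR_conv_of_real[symmetric] scaleR_complex.sel)
    then show ?thesis
      using quad[OF m] quad[OF n] by simp
  qed
  have disc_f: "disc_form m n z = Re (cnj (f m (z, - 1)) * f n (z, - 1))" for m n z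
    by (simp add: disc_form_def f_def)
  have vz: "v (z, - 1) = z *\<^sub>C x - y" for z
    by (simp add: v_def scaleC_minus_left scaleC_one)
  show ?thesis
  proof (intro exI[of _ S] conjI ballI)
    show "m + n \<in> S" if "m \<in> S" "n \<in> S" for m n
    proof -
      have "f (m + n) q = f m q + f n q" for q by (simp add: f_def algebra_simps)
      then show ?thesis using that by (simp add: S_def)
    qed
    show "0 \<le> Re (cnj (fst m) * fst n)" if "m \<in> S" "n \<in> S" for m n
      using inC[OF that, of "(1, 0)"] xy by (simp add: v_def f_def scaleC_one)
    show "0 \<le> Re (cnj (snd m) * snd n)" if "m \<in> S" "n \<in> S" for m n
      using inC[OF that, of "(0, 1)"] xy by (simp add: v_def f_def scaleC_one)
    show "E_set C x y = {z. \<exists>m\<in>S. \<exists>n\<in>S. disc_form m n z < 0}"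
    proof (intro set_eqI iffI)
      fix z assume "z \<in> {z. \<exists>m\<in>S. \<exists>n\<in>S. disc_form m n z < 0}"
      then obtain m n where "m \<in> S" "n \<in> S" "disc_form m n z < 0" by auto
      then have "v (z, - 1) \<notin> C" using inC[of m n "(z, - 1)"] by (auto simp: disc_f)
      then show "z \<in> E_set C x y" by (simp add: E_set_def vz)
    next
      fix z assume z: "z \<in> E_set C x y"
      show "z \<in> {z. \<exists>m\<in>S. \<exists>n\<in>S. disc_form m n z < 0}"
      proof (rule ccontr)
        assume "z \<notin> {z. \<exists>m\<in>S. \<exists>n\<in>S. disc_form m n z < 0}"
        then have "0 \<le> Re (cnj a * b)" if "a \<in> (\<lambda>m. f m (z, - 1)) ` S" "b \<in> (\<lambda>m. f m (z, - 1)) ` S" for a b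
          using that by (auto simp: disc_f not_less)
        then obtain c where c: "c \<noteq> 0" and quad: "\<And>m. m \<in> S \<Longrightarrow> 0 \<le> Re (c * f m (z, - 1)) \<and> 0 \<le> Im (c * f m (z, - 1))"
          using quarter_plane_rotation[of "(\<lambda>m. f m (z, - 1)) ` S"] by auto
        have mem: "d *\<^sub>C v (z, - 1) \<in> P" if d: "\<And>m. m \<in> S \<Longrightarrow> 0 \<le> Re (d * f m (z, - 1))" for d
        proof (rule ccontr)
          assume "d *\<^sub>C v (z, - 1) \<notin> P"
          then have "(d * z, d * (- 1)) \<notin> Q" using vc[of d z "- 1"] by (simp add: Q_def)
          then obtain \<alpha> \<beta> where ab: "\<And>q. q \<in> Q \<Longrightarrow> 0 \<le> Re (\<alpha> * fst q + \<beta> * snd q)"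
            "Re (\<alpha> * fst (d * z, d * (- 1)) + \<beta> * snd (d * z, d * (- 1))) < 0"
            using convex_cone_separating_functional[OF Q] by metis
          have "(\<alpha>, \<beta>) \<in> S" using ab(1) by (simp add: S_def f_def)
          then have "0 \<le> Re (f (\<alpha>, \<beta>) (d * z, d * (- 1)))" using d fc[of "(\<alpha>, \<beta>)" d z "- 1"] by simp
          then show False using ab(2) by (simp add: f_def)
        qed
        have "c *\<^sub>C v (z, - 1) \<in> P" using mem[of c] quad by blast
        moreover have "(- \<i> * c) *\<^sub>C v (z, - 1) \<in> P"
        proof (rule mem)
          fix m assume "m \<in> S"
          then have "0 \<le> Im (c * f m (z, - 1))" using quad by blast
          then show "0 \<le> Re (- \<i> * c * f m (z, - 1))" by (simp add: mult.assoc)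
        qed
        ultimately have "c *\<^sub>C v (z, - 1) \<in> R" using RP by (simp add: scaleC_scaleC)
        moreover have "v (z, - 1) = (1 / c) *\<^sub>C (c *\<^sub>C v (z, - 1))" using c by (simp add: scaleC_scaleC scaleC_one)
        moreover have "1 / c \<noteq> 0" using c by simp
        ultimately have "v (z, - 1) \<in> C" using C1 unfolding cond_C1_def by blast
        then show False using z by (simp add: E_set_def vz)
      qed
    qed
  qed
qed

lemma E_set_open_connected:
  fixes R C :: "'a::complex_banach set"
  assumes R: "closed_convex_cone R" and C1: "cond_C1 R C" and xy: "x \<in> C" "y \<in> C"
  shows "open (E_set C x y)" "connected (E_set C x y)"
proof -
  obtain S where S: "\<forall>m\<in>S. \<forall>n\<in>S. m + n \<in> S \<and> 0 \<le> Re (cnj (fst m) * fst n) \<and> 0 \<le> Re (cnj (snd m) * snd n)"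
    and E: "E_set C x y = {z. \<exists>m\<in>S. \<exists>n\<in>S. disc_form m n z < 0}"
    using E_set_union_of_discs[OF assms] by (elim exE conjE)
  show "connected (E_set C x y)"
    unfolding E using S by (intro connected_union_of_discs) simp_all
  have "open {z. disc_form m n z < 0}" for m n
    unfolding disc_form_def by (intro open_Collect_less continuous_intros)
  moreover have "E_set C x y = (\<Union>m\<in>S. \<Union>n\<in>S. {z. disc_form m n z < 0})"
    unfolding E by auto
  ultimately show "open (E_set C x y)" by (auto intro!: open_UN)
qed

section \<open>Comparison of the two gauges\<close>

text \<open>
  A constant function avoiding a half plane is enough to see this from the general bound.
\<close>

lemma poincare_dist_disc_nonneg:
  assumes "a \<in> ball 0 1" "b \<in> ball 0 1"
  shows "0 \<le> poincare_dist_disc a b"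
proof -
  let ?T = "{z::complex. Re z \<le> 0}"
  have "\<not> bounded ?T"
  proof
    assume "bounded ?T"
    then obtain B where B: "\<And>z. Re z \<le> 0 \<Longrightarrow> cmod z \<le> B" by (auto simp: bounded_iff)
    have n: "cmod (- of_real (\<bar>B\<bar> + 1)) = \<bar>B\<bar> + 1"
      unfolding norm_minus_cancel norm_of_real by simp
    have "\<bar>B\<bar> + 1 \<le> B"
      by (rule B[of "- of_real (\<bar>B\<bar> + 1)", unfolded n]) simp
    then show False by linarith
  qed
  moreover have "connected ?T" by (intro convex_connected convex_halfspace_Re_le)
  moreover have "(\<lambda>_. 1) ` ball (0::complex) 1 \<inter> ?T = {}" by auto
  ultimately show ?thesis
    using poincare_dist_disc_lower_bound[of "\<lambda>_. 1" ?T a b] assms by simp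
qed

text \<open>
  The Moebius map \<open>z \<mapsto> (z - p) / (z - q)\<close> on the sphere; its value at the pole \<open>q\<close> is a
  dummy.
\<close>

fun pole_chart :: "complex \<Rightarrow> complex \<Rightarrow> riemann_sphere \<Rightarrow> complex" where
  "pole_chart p q (Finite_Pt z) = (z - p) / (z - q)"
| "pole_chart p q Infinity_Pt = 1"

lemma open_sphere_delete: "open {w. w \<noteq> Infinity_Pt}" "open {w. w \<noteq> Finite_Pt 0}"
proof -
  have "Finite_Pt -` {w. w \<noteq> Infinity_Pt} = UNIV" "Finite_Pt -` {w. w \<noteq> Finite_Pt 0} = - {0}"
    by auto
  then show "open {w. w \<noteq> Infinity_Pt}" "open {w. w \<noteq> Finite_Pt 0}"
    by (simp_all add: open_riemann_sphere_def open_Compl)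
qed

lemma holomorphic_pole_chart:
  assumes f: "holomorphic_to_sphere f D" and D: "open D"
    and q: "q \<noteq> 0" and nq: "\<And>\<zeta>. \<zeta> \<in> D \<Longrightarrow> f \<zeta> \<noteq> Finite_Pt q"
  shows "(pole_chart p q \<circ> f) holomorphic_on D"
proof -
  let ?A = "{\<zeta> \<in> D. f \<zeta> \<noteq> Infinity_Pt}" and ?B = "{\<zeta> \<in> D. f \<zeta> \<noteq> Finite_Pt 0}"
  have cont: "continuous_on D f" and holA: "(coord_zero \<circ> f) holomorphic_on ?A"
    and holB: "(coord_infty \<circ> f) holomorphic_on ?B"
    using f by (auto simp: holomorphic_to_sphere_def)
  have "?A = D \<inter> f -` {w. w \<noteq> Infinity_Pt}" "?B = D \<inter> f -` {w. w \<noteq> Finite_Pt 0}" by auto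
  then have open_AB: "open ?A" "open ?B"
    using continuous_open_preimage[OF cont D] open_sphere_delete by (simp_all only:)
  have "(\<lambda>\<zeta>. ((coord_zero \<circ> f) \<zeta> - p) / ((coord_zero \<circ> f) \<zeta> - q)) holomorphic_on ?A"
  proof (intro holomorphic_intros holA)
    fix \<zeta> assume "\<zeta> \<in> ?A"
    then show "(coord_zero \<circ> f) \<zeta> - q \<noteq> 0" using nq[of \<zeta>] by (cases "f \<zeta>") auto
  qed
  then have A: "(pole_chart p q \<circ> f) holomorphic_on ?A"
  proof (rule holomorphic_transform)
    fix \<zeta> assume "\<zeta> \<in> ?A"
    then show "((coord_zero \<circ> f) \<zeta> - p) / ((coord_zero \<circ> f) \<zeta> - q) = (pole_chart p q \<circ> f) \<zeta>"
      by (cases "f \<zeta>") auto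
  qed
  have "(\<lambda>\<zeta>. (1 - p * (coord_infty \<circ> f) \<zeta>) / (1 - q * (coord_infty \<circ> f) \<zeta>)) holomorphic_on ?B"
  proof (intro holomorphic_intros holB)
    fix \<zeta> assume "\<zeta> \<in> ?B"
    then show "1 - q * (coord_infty \<circ> f) \<zeta> \<noteq> 0"
      using nq[of \<zeta>] by (cases "f \<zeta>") (auto simp: field_simps)
  qed
  then have B: "(pole_chart p q \<circ> f) holomorphic_on ?B"
  proof (rule holomorphic_transform)
    fix \<zeta> assume "\<zeta> \<in> ?B"
    then show "(1 - p * (coord_infty \<circ> f) \<zeta>) / (1 - q * (coord_infty \<circ> f) \<zeta>) = (pole_chart p q \<circ> f) \<zeta>"
      using nq[of \<zeta>] by (cases "f \<zeta>") (auto simp: divide_simps)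
  qed
  have "(pole_chart p q \<circ> f) holomorphic_on (?A \<union> ?B)"
    using A B open_AB by (rule holomorphic_on_Un)
  moreover have "?A \<union> ?B = D" by auto
  ultimately show ?thesis by simp
qed

lemma unbounded_moebius_image:
  fixes E :: "complex set"
  assumes E: "open E" "q \<in> E" and pq: "p \<noteq> q"
  shows "\<not> bounded ((\<lambda>z. (z - p) / (z - q)) ` (E - {q}))"
proof
  assume "bounded ((\<lambda>z. (z - p) / (z - q)) ` (E - {q}))"
  then obtain K where K: "\<And>z. z \<in> E \<Longrightarrow> z \<noteq> q \<Longrightarrow> cmod ((z - p) / (z - q)) \<le> K"
    by (auto simp: bounded_iff)
  obtain e where e: "e > 0" "ball q e \<subseteq> E" using E open_contains_ball by blast
  define r where "r = min (e / 2) (cmod (q - p) / (\<bar>K\<bar> + 2))"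
  have r: "0 < r" "r < e" using e(1) pq by (auto simp: r_def add_nonneg_pos)
  have "r \<le> cmod (q - p) / (\<bar>K\<bar> + 2)" by (simp add: r_def)
  then have "r * (\<bar>K\<bar> + 2) \<le> cmod (q - p)" by (simp add: pos_le_divide_eq)
  then have rK: "\<bar>K\<bar> * r + 2 * r \<le> cmod (q - p)" by (simp add: algebra_simps)
  have "q + of_real r \<in> E" using e(2) r by (auto simp: dist_norm)
  then have "cmod ((q + of_real r - p) / (q + of_real r - q)) \<le> K" using r by (intro K) auto
  then have "cmod (q - p + of_real r) \<le> K * r" using r by (simp add: norm_divide field_simps)
  moreover have "cmod (q - p) - r \<le> cmod (q - p + of_real r)"
    using norm_diff_ineq[of "q - p" "of_real r :: complex"] r by simp
  moreover have "K * r \<le> \<bar>K\<bar> * r" using r by (intro mult_right_mono) auto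
  ultimately show False using r(1) rK by linarith
qed

text \<open>
  The omitted set is the image of \<open>E - {q}\<close> under \<open>z \<mapsto> (z - p) / (z - q)\<close>: connected because \<open>E\<close>
  is open and connected, unbounded because \<open>q\<close> is interior to \<open>E\<close>, and containing \<open>0\<close> because of \<open>p\<close>.
\<close>

lemma poincare_dist_disc_E_set:
  fixes R C :: "'a::complex_banach set"
  assumes R: "closed_convex_cone R" and C1: "cond_C1 R C" and xy: "x \<in> C" "y \<in> C"
    and f: "holomorphic_to_sphere f (ball 0 1)" "f ` ball 0 1 \<subseteq> L_set C x y"
    and ab: "a \<in> ball 0 1" "b \<in> ball 0 1" "f a = Finite_Pt 0" "f b = Infinity_Pt"
    and pq: "p \<in> E_set C x y" "q \<in> E_set C x y"
  shows "ln (cmod q / cmod p) / 2 \<le> poincare_dist_disc a b"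
proof (cases "p = q")
  case True
  then show ?thesis using poincare_dist_disc_nonneg[OF ab(1,2)] by simp
next
  case False
  let ?E = "E_set C x y"
  let ?m = "\<lambda>z. (z - p) / (z - q)"
  have fL: "f \<zeta> \<in> L_set C x y" if "\<zeta> \<in> ball 0 1" for \<zeta>
    using f(2) imageI[OF that] by (rule subsetD)
  have disj: "z \<notin> ?E" if "f \<zeta> = Finite_Pt z" "\<zeta> \<in> ball 0 1" for z \<zeta>
    using fL[OF that(2)] that(1) by (auto simp: L_set_def E_set_def)
  have "0 \<notin> ?E" using disj[OF ab(3,1)] .
  then have nz: "p \<noteq> 0" "q \<noteq> 0" using pq by auto
  have "ln (cmod ((pole_chart p q \<circ> f) b) / cmod ((pole_chart p q \<circ> f) a)) / 2 \<le> poincare_dist_disc a b"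
  proof (rule poincare_dist_disc_lower_bound[where T = "?m ` (?E - {q})"])
    show "(pole_chart p q \<circ> f) holomorphic_on ball 0 1"
      using f(1) open_ball nz(2) by (rule holomorphic_pole_chart) (use disj pq in blast)
    have "connected (?E - {q})"
      using E_set_open_connected[OF R C1 xy] by (intro connected_open_delete) auto
    then show "connected (?m ` (?E - {q}))"
      by (intro connected_continuous_image continuous_intros) auto
    show "\<not> bounded (?m ` (?E - {q}))"
      using E_set_open_connected(1)[OF R C1 xy] pq(2) False by (rule unbounded_moebius_image)
    show "0 \<in> ?m ` (?E - {q})"
      using pq(1) False by (intro image_eqI[of _ _ p]) auto
    show "(pole_chart p q \<circ> f) ` ball 0 1 \<inter> ?m ` (?E - {q}) = {}"
    proof (rule equals0I, elim IntE imageE)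
      fix w \<zeta> z assume w: "w = (pole_chart p q \<circ> f) \<zeta>" "\<zeta> \<in> ball 0 1" "w = ?m z" "z \<in> ?E - {q}"
      show False
      proof (cases "f \<zeta>")
        case (Finite_Pt u)
        have "u \<notin> ?E" using disj[OF Finite_Pt w(2)] .
        then have "u \<noteq> q" "u \<noteq> z" using pq w(4) by auto
        have "(u - p) * (z - q) = (z - p) * (u - q)"
          using w \<open>u \<noteq> q\<close> by (simp add: Finite_Pt frac_eq_eq)
        then have "(u - z) * (p - q) = 0" by (simp add: algebra_simps)
        then show False using \<open>u \<noteq> z\<close> False by simp
      next
        case Infinity_Pt
        then show False using w False by (auto simp: divide_simps split: if_splits)
      qed
    qed
  qed (use ab in auto)
  then show ?thesis using nz by (simp add: ab norm_divide)
qed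

text \<open>
  The supremum and infimum defining \<^const>\<open>delta_gauge\<close> are finite and positive as soon as all
  quotients of moduli are bounded, and the bound passes to their quotient.
\<close>

lemma half_delta_gauge_le:
  assumes D: "0 \<le> D" and nc: "\<not> colinear x y" and z0: "0 \<notin> E_set C x y"
    and le: "\<And>p q. p \<in> E_set C x y \<Longrightarrow> q \<in> E_set C x y \<Longrightarrow> ln (cmod q / cmod p) / 2 \<le> D"
  shows "ereal (1 / 2) * delta_gauge C x y \<le> ereal D"
proof (cases "E_set C x y = {}")
  case True
  (* The supremum is -\<infinity> and the infimum \<infinity>; both have the real value 0, and ln (0 / 0) = 0. *)
  then show ?thesis using D nc by (simp add: delta_gauge_def bot_ereal_def top_ereal_def)
next
  case False
  let ?E = "E_set C x y"
  define K where "K = exp (2 * D)"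
  have K: "0 < K" by (simp add: K_def)
  have nz: "0 < cmod z" if "z \<in> ?E" for z using that z0 by auto
  have le': "cmod q \<le> K * cmod p" if "p \<in> ?E" "q \<in> ?E" for p q
  proof -
    have "ln (cmod q / cmod p) \<le> 2 * D" using le[OF that] by simp
    then have "exp (ln (cmod q / cmod p)) \<le> K" by (simp add: K_def)
    then have "cmod q / cmod p \<le> K" using nz that by simp
    then show ?thesis using nz[OF that(1)] by (simp add: divide_le_eq)
  qed
  define b where "b = (SUP z\<in>?E. ereal (cmod z))"
  define a where "a = (INF z\<in>?E. ereal (cmod z))"
  obtain z where z: "z \<in> ?E" using False by auto
  have "b \<le> ereal (K * cmod z)" unfolding b_def by (rule SUP_least) (use le' z in auto)
  moreover have "ereal (cmod z) \<le> b" unfolding b_def using z by (rule SUP_upper)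
  ultimately obtain b' where b': "b = ereal b'" "cmod z \<le> b'" by (cases b) auto
  have b'le: "b' \<le> K * cmod p" if "p \<in> ?E" for p
  proof -
    have "b \<le> ereal (K * cmod p)" unfolding b_def by (rule SUP_least) (use le' that in auto)
    then show ?thesis by (simp add: b')
  qed
  have "ereal (b' / K) \<le> a"
    unfolding a_def by (rule INF_greatest) (use b'le K in \<open>auto simp: divide_le_eq mult.commute\<close>)
  moreover have "a \<le> ereal (cmod z)" unfolding a_def using z by (rule INF_lower)
  ultimately obtain a' where a': "a = ereal a'" "b' / K \<le> a'" by (cases a) auto
  have b0: "0 < b'" using nz[OF z] b'(2) by linarith
  then have "0 < b' / K" using K by simp
  then have a0: "0 < a'" using a'(2) by linarith
  have "b' / a' \<le> K" using a'(2) a0 K by (simp add: divide_le_eq mult.commute)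
  then have "ln (b' / a') \<le> ln K" using a0 b0 K by (subst ln_le_cancel_iff) auto
  then have "ln (b' / a') \<le> 2 * D" by (simp add: K_def)
  moreover have "delta_gauge C x y = ereal (ln (b' / a'))"
    using nc a0 unfolding delta_gauge_def a_def[symmetric] b_def[symmetric] by (simp add: Let_def a'(1) b'(1))
  ultimately show ?thesis by simp
qed

theorem proposition5p2:
  fixes R C :: "'a :: complex_banach set"
  assumes "closed_convex_cone R"
    and "is_complex_cone C"
    and "cond_C1 R C"
    and "cond_C2 C"
  shows "\<forall>x\<in>C - {0}. \<forall>y\<in>C - {0}. ereal (1 / 2) * delta_gauge C x y \<le> d_gauge C x y"
proof (intro ballI)
  fix x y assume "x \<in> C - {0}" "y \<in> C - {0}"
  then have xy: "x \<in> C" "y \<in> C" by auto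
  let ?L = "L_set C x y"
  show "ereal (1 / 2) * delta_gauge C x y \<le> d_gauge C x y"
  proof (cases "\<not> colinear x y \<and> Finite_Pt 0 \<in> interior ?L \<and> Infinity_Pt \<in> interior ?L")
    case False
    then show ?thesis by (auto simp: d_gauge_def delta_gauge_def)
  next
    case True
    have "0 \<notin> E_set C x y"
      using True interior_subset[of ?L] by (auto simp: L_set_def E_set_def)
    have "ereal (1 / 2) * delta_gauge C x y \<le> poincare_dist (interior ?L) (Finite_Pt 0) Infinity_Pt"
      unfolding poincare_dist_def
    proof (rule Inf_greatest)
      fix d assume "d \<in> {ereal (poincare_dist_disc a b) | a b f.
            covering_space (ball 0 1) f (interior ?L) \<and> holomorphic_to_sphere f (ball 0 1) \<and>
            a \<in> ball 0 1 \<and> b \<in> ball 0 1 \<and> f a = Finite_Pt 0 \<and> f b = Infinity_Pt}"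
      then obtain a b f where d: "d = ereal (poincare_dist_disc a b)"
        and f: "covering_space (ball 0 1) f (interior ?L)" "holomorphic_to_sphere f (ball 0 1)"
        and ab: "a \<in> ball 0 1" "b \<in> ball 0 1" "f a = Finite_Pt 0" "f b = Infinity_Pt"
        by blast
      have im: "f ` ball 0 1 \<subseteq> ?L"
        using covering_space_imp_surjective[OF f(1)] interior_subset by simp
      show "ereal (1 / 2) * delta_gauge C x y \<le> d"
        unfolding d
        using poincare_dist_disc_nonneg[OF ab(1,2)] True \<open>0 \<notin> E_set C x y\<close>
          poincare_dist_disc_E_set[OF assms(1,3) xy f(2) im ab]
        by (intro half_delta_gauge_le) auto
    qed
    then show ?thesis using True by (simp add: d_gauge_def)
  qed
qed

end
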